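(* Let $n,m\in\mathbb N_0$, let $q\in\mathbb C$ with $0<|q|<1$, and let $\alpha,a,b,c\in\mathbb C\setminus\{0\}$. For $\beta\in\mathbb C\setminus\{0\}$ define $$\Psi_{m,n}(\beta):=\sum_{k=-\infty}^\infty(1+q^{2k}\beta^2)\,\mathsf p_n[q^k\beta;a,b,c|q]\,\mathsf p_m[q^k\beta;a,b,c|q]\,\prod_{t\in\{a,b,c\}}\Big(-q^{k+1}\beta t,\frac{q^{1-k}t}{\beta};q\Big)_\infty\; q^{2k^2-k}\beta^{4k},$$ where $\{a,b,c\}$ is a multiset (so the product has one factor for each of the three parameters). Then $$\Psi_{m,n}(\alpha)=\Big(q,-\alpha^2,-\frac q{\alpha^2},-qab,-qac,-qbc;q\Big)_\infty\,q^{-4\binom n2}\left(\frac{a^2b^2c^2}{q}\right)^n\Big(q,-\frac1{ab},-\frac1{ac},-\frac1{bc};q\Big)_n\,\delta_{m,n},$$ and $$\int_{-\infty}^\infty(1+q^{2x}\alpha^2)\,\mathsf p_n[q^x\alpha;a,b,c|q]\,\mathsf p_m[q^x\alpha;a,b,c|q]\prod_{t\in\{a,b,c\}}\Big(-q^{x+1}\alpha t,\frac{q^{1-x}t}{\alpha};q\Big)_\infty\;q^{2x^2-x}\alpha^{4x}\,dx$$ $$=\int_0^1\Psi_{m,n}(q^x\alpha)\,q^{2x^2-x}\alpha^{4x}\,dx$$ $$=\frac{\sqrt{2\pi}\,\alpha\,\exp\left(\frac{2(\log\alpha)^2}{\log q^{-1}}\right)(-qab,-qac,-qbc;q)_\infty}{q^{1/8}\sqrt{\log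 q^{-1}}}\,q^{-4\binom n2}\left(\frac{a^2b^2c^2}{q}\right)^n\Big(q,-\frac1{ab},-\frac1{ac},-\frac1{bc};q\Big)_n\,\delta_{m,n}.$$
   Context: Notation: $\mathbb N_0=\{0,1,2,\dots\}$. For $n\in\mathbb N_0$, $(y;q)_n=\prod_{j=0}^{n-1}(1-yq^j)$, $(y;q)_\infty=\prod_{j\ge0}(1-yq^j)$, and $(y_1,\dots,y_r;q)_k=\prod_i(y_i;q)_k$, also for $k=\infty$. $\delta_{m,n}$ is the Kronecker delta. Powers are $q^s=\exp(s\log q)$, $\alpha^{s}=\exp(s\log\alpha)$ with principal logarithms, $\log q^{-1}=-\log q$ (which has positive real part), and $\sqrt{\log q^{-1}}$ is the principal square root. The continuous dual $q^{-1}$-Hahn polynomials are polynomials of degree $n$ in $x=\frac12(z-z^{-1})$, defined by $\mathsf p_n[z;a,b,c|q]=i^{-n}p_n[iz;ia,ib,ic|q^{-1}]$, where $p_n$ is the continuous dual $q$-Hahn polynomial in standard normalization, written as a function of $w$ with argument $\frac12(w+w^{-1})$. Explicitly, $$\mathsf p_n[z;a,b,c|q]=q^{-2\binom n2}(-abc)^n\sum_{k=0}^n\frac{(q^{-n},\frac za,-\frac1{az};q)_k}{(q;q)_k}\Big(-\frac{q^n}{bc}\Big)^k\Big(-\frac{q^k}{ab},-\frac{q^k}{ac};q\Big)_{n-k}.$$ *)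

theory Defs
  imports "HOL-Analysis.Analysis" "HOL-Library.Multiset"
begin

definition qpoch :: "complex \<Rightarrow> complex \<Rightarrow> nat \<Rightarrow> complex" where
  "qpoch y q n = (\<Prod>j<n. 1 - y * q ^ j)"

definition qpochs :: "complex list \<Rightarrow> complex \<Rightarrow> nat \<Rightarrow> complex" where
  "qpochs ys q n = (\<Prod>y\<leftarrow>ys. qpoch y q n)"

definition qpoch_inf :: "complex \<Rightarrow> complex \<Rightarrow> complex" where
  "qpoch_inf y q = (\<Prod>j. 1 - y * q ^ j)"

definition qpochs_inf :: "complex list \<Rightarrow> complex \<Rightarrow> complex" where
  "qpochs_inf ys q = (\<Prod>y\<leftarrow>ys. qpoch_inf y q)"

lemma convergent_prod_qpoch:
  fixes y q :: complex
  assumes "norm q < 1"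
  shows "convergent_prod (\<lambda>j. 1 - y * q ^ j)"
proof (rule abs_convergent_prod_imp_convergent_prod)
  have "summable (\<lambda>j. norm y * norm q ^ j)"
    using assms by (intro summable_mult summable_geometric) auto
  then show "abs_convergent_prod (\<lambda>j. 1 - y * q ^ j)"
    by (simp add: abs_convergent_prod_conv_summable norm_mult norm_power)
qed

text \<open>
  The continuous dual \<open>q\<close>-Hahn polynomial of degree \<open>n\<close> at the point \<open>(w + 1 / w) / 2\<close>, in its
  standard normalization
  \<open>(ab, ac; q)\<^sub>n / a\<^sup>n \<cdot> \<^sub>3\<phi>\<^sub>2 (q\<^sup>-\<^sup>n, aw, a/w; ab, ac; q, q)\<close>.
  The factor \<open>(ab, ac; q)\<^sub>n\<close> is multiplied into the series, which removes the denominators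
  \<open>(ab, ac; q)\<^sub>k\<close>; see \<open>cd_qHahn_eq_3phi2\<close> below. The base \<open>q\<close> is not restricted to the unit disc.
\<close>

definition cd_qHahn :: "nat \<Rightarrow> complex \<Rightarrow> complex \<Rightarrow> complex \<Rightarrow> complex \<Rightarrow> complex \<Rightarrow> complex" where
  "cd_qHahn n w a b c q =
     (1 / a ^ n) * (\<Sum>k\<le>n. qpochs [q powi (- int n), a * w, a / w] q k / qpoch q q k * q ^ k *
        qpochs [a * b * q ^ k, a * c * q ^ k] q (n - k))"

text \<open>The continuous dual \<open>q\<^sup>-\<^sup>1\<close>-Hahn polynomial, at the point \<open>(z - 1 / z) / 2\<close>.\<close>

definition cd_qinv_Hahn :: "nat \<Rightarrow> complex \<Rightarrow> complex \<Rightarrow> complex \<Rightarrow> complex \<Rightarrow> complex \<Rightarrow> complex" where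
  "cd_qinv_Hahn n z a b c q =
     \<i> powi (- int n) * cd_qHahn n (\<i> * z) (\<i> * a) (\<i> * b) (\<i> * c) (inverse q)"

lemma qpoch_split: "k \<le> n \<Longrightarrow> qpoch y q n = qpoch y q k * qpoch (y * q ^ k) q (n - k)"
proof -
  assume "k \<le> n"
  then obtain d where n: "n = k + d" by (auto simp: le_iff_add)
  have "qpoch y q (k + d) = qpoch y q k * qpoch (y * q ^ k) q d"
    by (induction d) (simp_all add: qpoch_def power_add mult_ac)
  then show ?thesis by (simp add: n)
qed

lemma cd_qHahn_eq_3phi2:
  assumes "qpochs [a * b, a * c] q n \<noteq> 0"
  shows "cd_qHahn n w a b c q =
    qpochs [a * b, a * c] q n / a ^ n *
    (\<Sum>k\<le>n. qpochs [q powi (- int n), a * w, a / w] q k / qpochs [a * b, a * c, q] q k * q ^ k)"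
  unfolding cd_qHahn_def sum_distrib_left
proof (rule sum.cong[OF refl], goal_cases)
  case (1 k)
  then have k: "k \<le> n" by simp
  have "qpoch (a * b) q k \<noteq> 0" "qpoch (a * c) q k \<noteq> 0"
    using assms by (auto simp: qpochs_def qpoch_split[OF k])
  then show ?case
    by (simp add: qpochs_def qpoch_split[OF k, of "a * b"] qpoch_split[OF k, of "a * c"])
qed

lemma qpoch_inverse_base:
  assumes "q \<noteq> 0" "y \<noteq> 0"
  shows "qpoch y (inverse q) n = (- y) ^ n * inverse q ^ (n choose 2) * qpoch (1 / y) q n"
proof (induction n)
  case 0
  then show ?case by (simp add: qpoch_def numeral_2_eq_2)
next
  case (Suc n)
  have c: "Suc n choose 2 = n + (n choose 2)"
    by (simp add: numeral_2_eq_2)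
  have "1 - y * inverse q ^ n = - y * inverse q ^ n * (1 - 1 / y * q ^ n)"
    using assms by (simp add: field_simps)
  then show ?case
    using Suc by (simp add: qpoch_def c power_add mult_ac)
qed

lemma choose_two_add: "(k + d) choose 2 = (k choose 2) + (d choose 2) + k * d"
proof (induction d)
  case (Suc d)
  have "Suc m choose 2 = m + (m choose 2)" for m :: nat
    by (simp add: numeral_2_eq_2)
  then show ?case using Suc by simp
qed (simp add: numeral_2_eq_2)

lemma cd_qinv_Hahn_explicit:
  assumes nz: "q \<noteq> 0" "a \<noteq> 0" "b \<noteq> 0" "c \<noteq> 0" "z \<noteq> 0"
  shows "cd_qinv_Hahn n z a b c q =
    q powi (- 2 * int (n choose 2)) * (- (a * b * c)) ^ n *
    (\<Sum>k\<le>n. qpochs [q powi (- int n), z / a, - 1 / (a * z)] q k / qpoch q q k *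
       (- (q ^ n / (b * c))) ^ k *
       qpochs [- (q ^ k / (a * b)), - (q ^ k / (a * c))] q (n - k))"
  unfolding cd_qinv_Hahn_def cd_qHahn_def sum_distrib_left
proof (rule sum.cong[OF refl], goal_cases)
  case (1 k)
  then obtain d where n: "n = k + d" by (auto simp: le_iff_add)
  define Q where "Q = inverse q"
  have Q: "Q \<noteq> 0" using nz by (simp add: Q_def)
  have ii: "\<i> * x * (\<i> * y) = - (x * y)" for x y :: complex
    by (simp add: algebra_simps)
  have args: "inverse q powi (- int n) = q ^ n" "q powi (- int n) = 1 / q ^ n"
    "q powi (- 2 * int (n choose 2)) = Q ^ (2 * (n choose 2))"
    by (auto simp: Q_def power_int_def field_simps nat_mult_distrib binomial_eq_0)
  have e1: "qpoch (q ^ n) Q k = (- (q ^ n)) ^ k * Q ^ (k choose 2) * qpoch (1 / q ^ n) q k"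
    using nz by (simp add: Q_def qpoch_inverse_base)
  have e2: "qpoch Q Q k = (- Q) ^ k * Q ^ (k choose 2) * qpoch q q k"
    using nz qpoch_inverse_base[of q Q k] by (simp add: Q_def field_simps)
  have e3: "qpoch (- (a * z)) Q k = (a * z) ^ k * Q ^ (k choose 2) * qpoch (- 1 / (a * z)) q k"
    using nz by (simp add: Q_def qpoch_inverse_base)
  have e4: "qpoch (a / z) Q k = (- (a / z)) ^ k * Q ^ (k choose 2) * qpoch (z / a) q k"
    using nz by (simp add: Q_def qpoch_inverse_base)
  have e5: "qpoch (- (x * y) * Q ^ k) Q d =
      (x * y * Q ^ k) ^ d * Q ^ (d choose 2) * qpoch (- (q ^ k / (x * y))) q d"
    if "x \<noteq> 0" "y \<noteq> 0" for x y
  proof -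
    have "1 / (- (x * y) * Q ^ k) = - (q ^ k / (x * y))"
      using that nz by (simp add: Q_def field_simps)
    then show ?thesis
      using that nz qpoch_inverse_base[of q "- (x * y) * Q ^ k" d] by (simp add: Q_def)
  qed
  have mono: "\<i> powi (- int n) * (1 / (\<i> * a) ^ n) *
      (((- (q ^ n)) ^ k * Q ^ (k choose 2)) * ((a * z) ^ k * Q ^ (k choose 2)) *
       ((- (a / z)) ^ k * Q ^ (k choose 2)) / ((- Q) ^ k * Q ^ (k choose 2)) * Q ^ k *
       (((a * b * Q ^ k) ^ d * Q ^ (d choose 2)) * ((a * c * Q ^ k) ^ d * Q ^ (d choose 2)))) =
      Q ^ (2 * (n choose 2)) * (- (a * b * c)) ^ n * (- (q ^ n / (b * c))) ^ k" (is "?l = ?r")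
  proof -
    have "\<i> ^ n * (\<i> * a) ^ n = (\<i> * (\<i> * a)) ^ n"
      by (rule power_mult_distrib[symmetric])
    also have "\<i> * (\<i> * a) = - a" by (simp flip: mult.assoc)
    finally have "\<i> ^ n * (\<i> * a) ^ n = (- a) ^ n" .
    moreover have "\<i> powi (- int n) = 1 / \<i> ^ n"
      by (simp only: power_int_minus power_int_of_nat inverse_eq_divide)
    ultimately have i: "\<i> powi (- int n) * (1 / (\<i> * a) ^ n) = 1 / (- a) ^ n"
      by (simp only: times_divide_times_eq mult_1)
    have Qe: "Q ^ (2 * (n choose 2)) =
        Q ^ (k choose 2) * Q ^ (k choose 2) * Q ^ (d choose 2) * Q ^ (d choose 2) *
        ((Q ^ k) ^ d * (Q ^ k) ^ d)"
      by (simp add: n choose_two_add mult_2 add.assoc flip: power_add power_mult)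
    have s: "(- x) ^ m = (- 1) ^ m * x ^ m" for x :: complex and m
      by (metis mult_minus1 power_mult_distrib)
    have ss: "(- 1 :: complex) ^ m * (- 1) ^ m = 1" for m
      by (simp flip: power_mult_distrib)
    define S T :: complex where "S = (- 1) ^ k" and "T = (- 1) ^ d"
    have ST: "S * S = 1" "T * T = 1" "S \<noteq> 0" "T \<noteq> 0"
      using ss by (simp_all add: S_def T_def)
    have field: "1 / (S * T * (Ak * Ad)) * ((S * N * X) * (Ak * Zk * X) * (S * (Ak / Zk) * X) /
        (S * Qk * X) * Qk * ((Ad * Bd * W * Y) * (Ad * Cd * W * Y))) =
      X * X * Y * Y * (W * W) * (S * T * (Ak * Bk * Ck * (Ad * Bd * Cd))) * (S * (N / (Bk * Ck)))"
      if "X \<noteq> 0" "Ak \<noteq> 0" "Ad \<noteq> 0" "Zk \<noteq> 0" "Qk \<noteq> 0" "Bk \<noteq> 0" "Ck \<noteq> 0"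
      for X Y W N Ak Ad Zk Qk Bk Ck Bd Cd :: complex
    proof -
      have "S = 1 \<or> S = - 1" "T = 1 \<or> T = - 1"
        using ST by (simp_all add: square_eq_1_iff)
      then show ?thesis
        using that by (elim disjE) (simp_all add: divide_simps)
    qed
    have "?l = 1 / (S * T * (a ^ k * a ^ d)) * ((S * (q ^ n) ^ k * Q ^ (k choose 2)) *
        (a ^ k * z ^ k * Q ^ (k choose 2)) * (S * (a ^ k / z ^ k) * Q ^ (k choose 2)) /
        (S * Q ^ k * Q ^ (k choose 2)) * Q ^ k *
        ((a ^ d * b ^ d * (Q ^ k) ^ d * Q ^ (d choose 2)) *
         (a ^ d * c ^ d * (Q ^ k) ^ d * Q ^ (d choose 2))))"
    proof -
      have "(- a) ^ n = S * T * (a ^ k * a ^ d)"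
        unfolding s[of a] S_def T_def n power_add by (simp only: mult_ac)
      then show ?thesis
        unfolding i s[of "q ^ n"] s[of "a / z"] s[of Q] S_def[symmetric]
        by (simp only: power_mult_distrib power_divide)
    qed
    also have "\<dots> = Q ^ (2 * (n choose 2)) *
        (S * T * (a ^ k * b ^ k * c ^ k * (a ^ d * b ^ d * c ^ d))) * (S * ((q ^ n) ^ k / (b ^ k * c ^ k)))"
      unfolding Qe by (rule field) (use nz Q in simp_all)
    also have "\<dots> = ?r"
    proof -
      have "(- (a * b * c)) ^ n = S * T * (a ^ k * b ^ k * c ^ k * (a ^ d * b ^ d * c ^ d))"
        unfolding s[of "a * b * c"] S_def T_def n power_add power_mult_distrib by (simp only: mult_ac)
      then show ?thesis
        unfolding s[of "q ^ n / (b * c)"] S_def[symmetric] by (simp only: power_mult_distrib power_divide)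
    qed
    finally show ?thesis .
  qed
  have "\<i> powi (- int n) * (1 / (\<i> * a) ^ n *
      (qpochs [inverse q powi (- int n), \<i> * a * (\<i> * z), \<i> * a / (\<i> * z)] (inverse q) k /
       qpoch (inverse q) (inverse q) k * inverse q ^ k *
       qpochs [\<i> * a * (\<i> * b) * inverse q ^ k, \<i> * a * (\<i> * c) * inverse q ^ k] (inverse q) (n - k))) =
      ?l * (qpoch (1 / q ^ n) q k * qpoch (- 1 / (a * z)) q k * qpoch (z / a) q k / qpoch q q k *
        (qpoch (- (q ^ k / (a * b))) q d * qpoch (- (q ^ k / (a * c))) q d))"
  proof -
    have nk: "n - k = d" by (simp add: n)
    have div: "\<i> * a / (\<i> * z) = a / z" by simp
    have prods: "qpochs [x, y, w] r m = qpoch x r m * qpoch y r m * qpoch w r m"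
      "qpochs [x, y] r m = qpoch x r m * qpoch y r m" for x y w r m
      by (simp_all add: qpochs_def)
    show ?thesis
      unfolding args(1) ii div prods nk
      unfolding Q_def[symmetric] e1 e2 e3 e4 e5[OF nz(2,3)] e5[OF nz(2,4)]
      by (simp only: divide_inverse inverse_mult_distrib mult_ac)
  qed
  then show ?case
    unfolding mono args using n by (simp add: qpochs_def mult_ac)
qed

definition Psi_term ::
    "nat \<Rightarrow> nat \<Rightarrow> complex \<Rightarrow> complex \<Rightarrow> complex \<Rightarrow> complex \<Rightarrow> complex \<Rightarrow> int \<Rightarrow> complex" where
  "Psi_term m n a b c q \<beta> k =
     (1 + q powi (2 * k) * \<beta>\<^sup>2) *
     cd_qinv_Hahn n (q powi k * \<beta>) a b c q * cd_qinv_Hahn m (q powi k * \<beta>) a b c q *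
     (\<Prod>t\<in>#{#a, b, c#}. qpochs_inf [- (q powi (k + 1) * \<beta> * t), q powi (1 - k) * t / \<beta>] q) *
     q powi (2 * k\<^sup>2 - k) * \<beta> powi (4 * k)"

definition Psi :: "nat \<Rightarrow> nat \<Rightarrow> complex \<Rightarrow> complex \<Rightarrow> complex \<Rightarrow> complex \<Rightarrow> complex \<Rightarrow> complex" where
  "Psi m n a b c q \<beta> = (\<Sum>\<^sub>\<infinity>k\<in>UNIV. Psi_term m n a b c q \<beta> k)"

text \<open>
  The integrand over the real line. Real powers are taken with the principal logarithm:
  \<open>q powr s = exp (s * Ln q)\<close> for \<open>q \<noteq> 0\<close>.
\<close>

definition Psi_integrand ::
    "nat \<Rightarrow> nat \<Rightarrow> complex \<Rightarrow> complex \<Rightarrow> complex \<Rightarrow> complex \<Rightarrow> complex \<Rightarrow> real \<Rightarrow> complex" where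
  "Psi_integrand m n a b c q \<alpha> x =
     (1 + q powr complex_of_real (2 * x) * \<alpha>\<^sup>2) *
     cd_qinv_Hahn n (q powr complex_of_real x * \<alpha>) a b c q * cd_qinv_Hahn m (q powr complex_of_real x * \<alpha>) a b c q *
     (\<Prod>t\<in>#{#a, b, c#}. qpochs_inf [- (q powr complex_of_real (x + 1) * \<alpha> * t), q powr complex_of_real (1 - x) * t / \<alpha>] q) *
     q powr complex_of_real (2 * x\<^sup>2 - x) * \<alpha> powr complex_of_real (4 * x)"

end

theory Submission
  imports Defs "HOL-Probability.Probability" "HOL-Complex_Analysis.Complex_Analysis"
begin

text \<open>
  Write \<open>z = q\<^sup>k\<beta>\<close> and \<open>X = z - 1 / z\<close>. The summand of \<open>\<Psi>\<close> is a polynomial in \<open>X\<close> times a weight that is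
  symmetric in \<open>a, b, c\<close>. The basic observation is that \<open>(z/a, -1/(az); q)\<^sub>k\<close> is a polynomial of degree \<open>k\<close>
  in \<open>X\<close> whose product with the weight is a constant multiple of the same weight with \<open>a\<close>
  replaced by \<open>a / q\<^sup>k\<close> (\<open>poly_basis_poly_theta_pair\<close>). Hence every sum of a polynomial against the weight
  is a linear combination of total masses of weights with shifted parameters. This settles convergence,
  and it reduces the evaluation of \<open>\<Psi>\<close> to that of the total mass.

  \<^bold>\<open>Total mass.\<close> A telescoping sum gives the contiguous relation
  \<open>mass (a/q) b c = (1 + ab) (1 + ac) mass a b c\<close> (\<open>mass_contiguous\<close>). Iterating it towards \<open>a \<rightarrow> 0\<close>, and
  then doing the same with \<open>b\<close> and \<open>c\<close>, splits off \<open>(-qab, -qac, -qbc; q)\<^sub>\<infinity>\<close> and leaves the mass with all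
  parameters zero, which is a theta series in \<open>\<beta>\<close>. That series need not be summed directly: for
  \<open>a = \<beta>\<close>, \<open>b = -1/\<beta>\<close>, \<open>c = 0\<close> all terms except \<open>k = 0\<close> vanish, and comparing the two values of this
  mass yields its product formula (\<open>mass_000\<close>), which is the Jacobi triple product.

  \<^bold>\<open>Orthogonality.\<close> By symmetry let \<open>m \<le> n\<close>. Expand \<open>p\<^sub>n\<close> in the basis belonging to \<open>a\<close> and \<open>p\<^sub>m\<close> in the one
  belonging to \<open>b\<close>. The sum of \<open>p\<^sub>n\<close> against the \<open>j\<close>-th basis element of \<open>b\<close> is, up to a factor, a terminating sum that
  \<open>qChu_Vandermonde\<close> evaluates to \<open>(q\<^sup>-\<^sup>j; q)\<^sub>n\<close> (\<open>pairing_hahn_basis\<close>). This vanishes for \<open>j < n\<close>, so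
  only \<open>j = m = n\<close> survives, with a coefficient that is known because the polynomials are monic in \<open>X\<close>.

  \<^bold>\<open>Integral.\<close> The integrand at \<open>x + k\<close> is the \<open>k\<close>-th term of \<open>\<Psi>(q\<^sup>x\<alpha>)\<close> times a Gaussian factor in \<open>x\<close>,
  so cutting the real line into unit intervals gives the integral over \<open>[0, 1]\<close> (\<open>line_integral_fold\<close>).
  Since \<open>\<Psi>(\<beta>)\<close> is a constant times the mass with zero parameters, the same folding, read backwards with
  \<open>a = b = c = 0\<close>, turns that integral into a constant times two Gaussian integrals over the line. Their
  quadratic coefficient \<open>2 log q\<close> is complex, and they are evaluated by analytic continuation from the real
  case (\<open>gaussian_integral\<close>).
\<close>

section \<open>Infinite \<open>q\<close>-Pochhammer symbols\<close>

lemma qpoch_Suc: "qpoch y q (Suc n) = qpoch y q n * (1 - y * q ^ n)"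
  by (simp add: qpoch_def)

lemma qpoch_0 [simp]: "qpoch y q 0 = 1"
  by (simp add: qpoch_def)

lemma qpoch_inf_0 [simp]: "qpoch_inf 0 q = 1"
  by (simp add: qpoch_inf_def)

lemma qpoch_tendsto_qpoch_inf:
  assumes "norm q < 1"
  shows "(\<lambda>n. qpoch y q n) \<longlonglongrightarrow> qpoch_inf y q"
proof -
  have "(\<lambda>n. \<Prod>i\<le>n. 1 - y * q ^ i) \<longlonglongrightarrow> qpoch_inf y q"
    unfolding qpoch_inf_def
    by (intro convergent_prod_LIMSEQ convergent_prod_qpoch assms)
  then have "(\<lambda>n. qpoch y q (Suc n)) \<longlonglongrightarrow> qpoch_inf y q"
    by (simp only: qpoch_def lessThan_Suc_atMost)
  then show ?thesis by (rule LIMSEQ_imp_Suc)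
qed

lemma qpoch_inf_split:
  assumes "norm q < 1"
  shows "qpoch_inf y q = qpoch y q n * qpoch_inf (y * q ^ n) q"
proof (rule LIMSEQ_unique)
  show "(\<lambda>k. qpoch y q (k + n)) \<longlonglongrightarrow> qpoch_inf y q"
    using qpoch_tendsto_qpoch_inf[OF assms, of y] by (rule LIMSEQ_ignore_initial_segment)
  have "qpoch y q (k + n) = qpoch y q n * qpoch (y * q ^ n) q k" for k
    using qpoch_split[of n "k + n" y q] by simp
  then show "(\<lambda>k. qpoch y q (k + n)) \<longlonglongrightarrow> qpoch y q n * qpoch_inf (y * q ^ n) q"
    by (simp only:) (intro tendsto_intros qpoch_tendsto_qpoch_inf assms)
qed

lemma qpoch_inf_step:
  assumes "norm q < 1"
  shows "qpoch_inf y q = (1 - y) * qpoch_inf (y * q) q"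
  using qpoch_inf_split[OF assms, of y 1] by (simp add: qpoch_def)

lemma qpoch_inf_eq_0:
  assumes "norm q < 1" "y * q ^ j = 1"
  shows "qpoch_inf y q = 0"
  using qpoch_inf_split[OF assms(1), of y "Suc j"] assms(2) by (simp add: qpoch_Suc)

text \<open>
  For \<open>y = q\<close> this allows the division by \<open>(q; q)\<^sub>\<infinity>\<close> in \<open>mass_000\<close>.
\<close>

lemma qpoch_inf_nonzero:
  assumes "norm q < 1" "norm y < 1"
  shows "qpoch_inf y q \<noteq> 0"
  unfolding qpoch_inf_def
proof (rule prodinf_nonzero)
  show "convergent_prod (\<lambda>j. 1 - y * q ^ j)" by (rule convergent_prod_qpoch[OF assms(1)])
  fix j
  have "norm (y * q ^ j) \<le> norm y"
    using assms power_le_one[of "norm q" j] by (simp add: norm_mult norm_power mult_left_le)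
  then have "norm (y * q ^ j) < 1" using assms(2) by simp
  then show "1 - y * q ^ j \<noteq> 0" by (metis eq_iff_diff_eq_0 less_irrefl norm_one)
qed

text \<open>
  Expanding the product, its distance from 1 is at most that of \<open>\<Prod>\<^sub>j (1 + |y| |q|\<^sup>j)\<close> from 1,
  and each factor is at most \<open>exp (|y| |q|\<^sup>j)\<close>. This one estimate gives both an upper bound and
  the limit at \<open>y \<rightarrow> 0\<close>.
\<close>

lemma norm_qpoch_inf_minus_1_le:
  assumes "norm q < 1"
  shows "norm (qpoch_inf y q - 1) \<le> exp (norm y / (1 - norm q)) - 1"
proof (rule LIMSEQ_le_const2)
  show "(\<lambda>n. norm (qpoch y q n - 1)) \<longlonglongrightarrow> norm (qpoch_inf y q - 1)"
    by (intro tendsto_intros qpoch_tendsto_qpoch_inf assms)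
  have "norm (qpoch y q n - 1) \<le> exp (norm y / (1 - norm q)) - 1" for n
  proof -
    have "norm (qpoch y q n - 1) \<le> (\<Prod>j<n. 1 + norm (- (y * q ^ j))) - 1"
      using norm_prod_minus1_le_prod_minus1[of "\<lambda>j. - (y * q ^ j)" "{..<n}"]
      by (simp add: qpoch_def)
    also have "(\<Prod>j<n. 1 + norm (- (y * q ^ j))) \<le> (\<Prod>j<n. exp (norm y * norm q ^ j))"
      by (intro prod_mono) (simp add: norm_mult norm_power)
    also have "\<dots> = exp (norm y * (\<Sum>j<n. norm q ^ j))"
      by (simp add: exp_sum sum_distrib_left)
    also have "(\<Sum>j<n. norm q ^ j) \<le> (\<Sum>j. norm q ^ j)"
      using assms by (intro sum_le_suminf summable_geometric) auto
    also have "(\<Sum>j. norm q ^ j) = 1 / (1 - norm q)"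
      using assms by (intro suminf_geometric) auto
    finally show ?thesis by (simp add: mult_left_mono)
  qed
  then show "\<exists>N. \<forall>n\<ge>N. norm (qpoch y q n - 1) \<le> exp (norm y / (1 - norm q)) - 1" by blast
qed

lemma norm_qpoch_inf_le:
  assumes "norm q < 1" "norm y \<le> A"
  shows "norm (qpoch_inf y q) \<le> exp (A / (1 - norm q))"
proof -
  have "norm (qpoch_inf y q) \<le> 1 + norm (qpoch_inf y q - 1)"
    using norm_triangle_ineq[of 1 "qpoch_inf y q - 1"] by simp
  also have "\<dots> \<le> exp (norm y / (1 - norm q))"
    using norm_qpoch_inf_minus_1_le[OF assms(1), of y] by simp
  also have "\<dots> \<le> exp (A / (1 - norm q))"
    using assms by (simp add: divide_right_mono)
  finally show ?thesis .
qed

lemma tendsto_qpoch_inf_1: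
  assumes "norm q < 1" "(y \<longlongrightarrow> 0) F"
  shows "((\<lambda>x. qpoch_inf (y x) q) \<longlongrightarrow> 1) F"
proof -
  have "((\<lambda>x. exp (norm (y x) / (1 - norm q)) - 1) \<longlongrightarrow> exp (norm (0::complex) / (1 - norm q)) - 1) F"
    by (intro tendsto_intros assms) (use assms in auto)
  then have "((\<lambda>x. exp (norm (y x) / (1 - norm q)) - 1) \<longlongrightarrow> 0) F" by simp
  then have "((\<lambda>x. qpoch_inf (y x) q - 1) \<longlongrightarrow> 0) F"
    by (rule Lim_null_comparison[rotated])
       (auto intro!: always_eventually norm_qpoch_inf_minus_1_le assms)
  then show ?thesis by (simp add: LIM_zero_iff)
qed

lemma borel_measurable_qpoch_inf [measurable]:
  assumes "norm q < 1" "f \<in> borel_measurable M"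
  shows "(\<lambda>x. qpoch_inf (f x) q) \<in> borel_measurable M"
proof (rule borel_measurable_LIMSEQ_metric)
  show "(\<lambda>x. qpoch (f x) q n) \<in> borel_measurable M" for n
    unfolding qpoch_def using assms(2) by measurable
  show "(\<lambda>n. qpoch (f x) q n) \<longlonglongrightarrow> qpoch_inf (f x) q" for x
    by (rule qpoch_tendsto_qpoch_inf[OF assms(1)])
qed

lemma qpoch_Suc_left: "qpoch y q (Suc n) = (1 - y) * qpoch (y * q) q n"
  using qpoch_split[of 1 "Suc n" y q] by (simp add: qpoch_def)

lemma Suc_choose_two: "Suc n choose 2 = n + (n choose 2)"
  by (simp add: numeral_2_eq_2)

text \<open>
  Lowering a parameter by \<open>q\<^sup>k\<close> adds \<open>k\<close> factors \<open>1 + x q\<^sup>-\<^sup>j\<close>, and reversing each of them turns the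
  extra product into a finite \<open>q\<close>-Pochhammer symbol in \<open>-1/x\<close>.
\<close>

lemma qpoch_inf_shift_down:
  assumes "norm q < 1" "q \<noteq> 0" "x \<noteq> 0"
  shows "qpoch_inf (- (q * (x / q ^ k))) q =
    qpoch_inf (- (q * x)) q * (x ^ k / q ^ (k choose 2)) * qpoch (- (1 / x)) q k"
proof (induction k)
  case 0
  then show ?case by (simp add: numeral_2_eq_2)
next
  case (Suc k)
  have "qpoch_inf (- (q * (x / q ^ Suc k))) q =
      (1 + x / q ^ k) * qpoch_inf (- (q * (x / q ^ k))) q"
    using qpoch_inf_step[OF assms(1), of "- (q * (x / q ^ Suc k))"] assms by (simp add: mult.commute)
  also have "1 + x / q ^ k = x / q ^ k * (1 - (- (1 / x)) * q ^ k)"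
    using assms by (simp add: field_simps)
  finally show ?case
    unfolding Suc.IH by (simp add: qpoch_Suc Suc_choose_two power_add field_simps)
qed

section \<open>A terminating summation of Chu-Vandermonde type\<close>

text \<open>
  This is \<open>(-1)\<^sup>k q\<^bsup>k(k-1)/2\<^esup>\<close> times the Gaussian binomial coefficient, that is,
  \<open>(q\<^sup>-\<^sup>n; q)\<^sub>k q\<^bsup>nk\<^esup> / (q; q)\<^sub>k\<close>. The signed form vanishes for \<open>k > n\<close> and has no negative
  powers of \<open>q\<close>.
\<close>

definition qbin :: "complex \<Rightarrow> nat \<Rightarrow> nat \<Rightarrow> complex" where
  "qbin q n k = (\<Prod>j<k. (q ^ n - q ^ j) / (1 - q ^ Suc j))"

lemma qbin_eq:
  assumes "q \<noteq> 0"
  shows "qpoch (q powi (- int n)) q k / qpoch q q k * (q ^ n) ^ k = qbin q n k"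
proof -
  have "q powi (- int n) = 1 / q ^ n"
    by (simp add: power_int_minus inverse_eq_divide)
  moreover have "qpoch (1 / q ^ n) q k * (q ^ n) ^ k = (\<Prod>j<k. q ^ n - q ^ j)"
    using assms by (induction k) (simp_all add: qpoch_Suc field_simps)
  moreover have "qpoch q q k = (\<Prod>j<k. 1 - q ^ Suc j)"
    by (simp add: qpoch_def)
  ultimately show ?thesis
    by (simp add: qbin_def prod_dividef)
qed

lemma qbin_0 [simp]: "qbin q n 0 = 1"
  by (simp add: qbin_def)

lemma qbin_eq_0: "n < k \<Longrightarrow> qbin q n k = 0"
  unfolding qbin_def by (rule prod_zero) auto

lemma one_minus_power_nonzero:
  fixes q :: complex
  assumes "norm q < 1"
  shows "1 - q ^ Suc j \<noteq> 0"
proof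
  assume "1 - q ^ Suc j = 0"
  then have "norm q ^ Suc j = 1" by (metis eq_iff_diff_eq_0 norm_one norm_power)
  moreover have "norm q ^ Suc j < 1" using assms power_Suc_less_one[of "norm q" j]
    by (cases "q = 0") simp_all
  ultimately show False by simp
qed

text \<open>
  The \<open>q\<close>-Pascal rule for Gaussian binomial coefficients.
\<close>

lemma qbin_Suc_Suc:
  assumes "norm q < 1"
  shows "qbin q (Suc n) (Suc k) = qbin q n (Suc k) - q ^ n * qbin q n k"
proof -
  have nz: "1 - q ^ Suc j \<noteq> 0" for j by (rule one_minus_power_nonzero[OF assms])
  have e1: "qbin q (Suc n) (Suc k) * (1 - q ^ Suc k) = (q ^ Suc n - 1) * q ^ k * qbin q n k"
  proof -
    have "(\<Prod>j<Suc k. q ^ Suc n - q ^ j) = (q ^ Suc n - 1) * (q ^ k * (\<Prod>j<k. q ^ n - q ^ j))"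
    proof -
      have "(\<Prod>j<Suc k. q ^ Suc n - q ^ j) = (q ^ Suc n - 1) * (\<Prod>j<k. q * (q ^ n - q ^ j))"
        by (subst prod.lessThan_Suc_shift) (simp add: algebra_simps)
      then show ?thesis by (simp add: prod.distrib)
    qed
    moreover have "(\<Prod>j<Suc k. 1 - q ^ Suc j) = (\<Prod>j<k. 1 - q ^ Suc j) * (1 - q ^ Suc k)"
      by simp
    ultimately show ?thesis
      using nz unfolding qbin_def prod_dividef by (simp add: mult_ac)
  qed
  have e2: "qbin q n (Suc k) * (1 - q ^ Suc k) = qbin q n k * (q ^ n - q ^ k)"
    using nz[of k] by (simp add: qbin_def)
  have "qbin q (Suc n) (Suc k) * (1 - q ^ Suc k) =
      (qbin q n (Suc k) - q ^ n * qbin q n k) * (1 - q ^ Suc k)"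
    unfolding e1 left_diff_distrib e2 by (simp add: algebra_simps)
  then show ?thesis using nz[of k] by (metis mult_right_cancel)
qed

text \<open>
  A polynomial form of the \<open>q\<close>-Chu-Vandermonde sum, which therefore holds for all \<open>s\<close> and \<open>v\<close>. The
  \<open>q\<close>-Pascal rule splits the sum for \<open>n + 1\<close> into one sum for \<open>n\<close> with the same \<open>v\<close> and one with \<open>qv\<close>.
  Both have the value \<open>(s; q)\<^sub>n\<close>, which does not depend on \<open>v\<close>, and the prefactors add up to
  \<open>1 - s q\<^sup>n\<close>.
\<close>

lemma qChu_Vandermonde:
  assumes "norm q < 1"
  shows "(\<Sum>k\<le>n. qbin q n k * s ^ k * qpoch v q k * qpoch (s * v * q ^ k) q (n - k)) = qpoch s q n"
proof (induction n arbitrary: v)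
  case 0
  then show ?case by simp
next
  case (Suc n)
  define t where "t n v k = s ^ k * qpoch v q k * qpoch (s * v * q ^ k) q (n - k)" for n v k
  have IH: "(\<Sum>k\<le>n. qbin q n k * t n v k) = qpoch s q n" for v
    using Suc.IH[of v] by (simp add: t_def mult.assoc)
  have t1: "t (Suc n) v k = t n v k * (1 - s * v * q ^ n)" if "k \<le> n" for k
    using that by (simp add: t_def Suc_diff_le qpoch_Suc power_add[symmetric] mult.assoc)
  have t2: "t (Suc n) v (Suc k) = s * (1 - v) * t n (v * q) k" for k
    by (simp add: t_def qpoch_Suc_left mult_ac)
  have "(\<Sum>k\<le>Suc n. qbin q (Suc n) k * t (Suc n) v k) =
      t (Suc n) v 0 + (\<Sum>k\<le>n. qbin q (Suc n) (Suc k) * t (Suc n) v (Suc k))"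
    by (subst sum.atMost_Suc_shift) simp
  also have "\<dots> = t (Suc n) v 0 + (\<Sum>k\<le>n. qbin q n (Suc k) * t (Suc n) v (Suc k))
      - q ^ n * (\<Sum>k\<le>n. qbin q n k * t (Suc n) v (Suc k))"
    unfolding qbin_Suc_Suc[OF assms] by (simp add: algebra_simps sum_subtractf sum_distrib_left)
  also have "t (Suc n) v 0 + (\<Sum>k\<le>n. qbin q n (Suc k) * t (Suc n) v (Suc k)) =
      (\<Sum>k\<le>Suc n. qbin q n k * t (Suc n) v k)"
    unfolding sum.atMost_Suc_shift by simp
  also have "\<dots> = (\<Sum>k\<le>n. qbin q n k * t n v k * (1 - s * v * q ^ n))"
    by (simp add: qbin_eq_0 t1 mult.assoc)
  also have "\<dots> = qpoch s q n * (1 - s * v * q ^ n)"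
    by (simp add: IH flip: sum_distrib_right)
  also have "(\<Sum>k\<le>n. qbin q n k * t (Suc n) v (Suc k)) = s * (1 - v) * qpoch s q n"
    unfolding t2 IH[of "v * q", symmetric] sum_distrib_left by (simp add: mult_ac)
  finally show ?case
    by (simp add: t_def qpoch_Suc algebra_simps)
qed


section \<open>Sums over the integers\<close>

lemma summable_on_nat_abs:
  fixes f :: "nat \<Rightarrow> real"
  assumes "summable f" "\<And>n. f n \<ge> 0"
  shows "(\<lambda>k::int. f (nat \<bar>k\<bar>)) summable_on UNIV"
proof -
  have f: "f summable_on UNIV"
    using assms by (simp add: summable_on_UNIV_nonneg_real_iff)
  have "(\<lambda>k::int. f (nat \<bar>k\<bar>)) summable_on range int"
    by (subst summable_on_reindex) (use f in \<open>simp_all add: o_def inj_on_def\<close>)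
  moreover have "(\<lambda>k::int. f (nat \<bar>k\<bar>)) summable_on range (\<lambda>n. - int n)"
    by (subst summable_on_reindex) (use f in \<open>simp_all add: o_def inj_on_def\<close>)
  moreover have "(UNIV :: int set) = range int \<union> range (\<lambda>n. - int n)"
    by (auto simp: image_iff) (metis int_cases2)
  ultimately show ?thesis by (metis summable_on_union)
qed

text \<open>
  Enumerating the integers gives access to theorems on ordinary series, such as Tannery's
  theorem and term-by-term integration.
\<close>

lemma infsum_int_eq_suminf:
  fixes f :: "int \<Rightarrow> complex"
  assumes "f summable_on UNIV"
  shows "(\<lambda>n. f (int_decode n)) sums infsum f UNIV"
proof (rule has_sum_imp_sums)
  show "((\<lambda>n. f (int_decode n)) has_sum infsum f UNIV) UNIV"
    using assms has_sum_reindex_bij_betw[of int_decode UNIV UNIV f] bij_int_decode by simp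
qed

lemma summable_on_int_imp_summable:
  fixes K :: "int \<Rightarrow> real"
  assumes "K summable_on UNIV"
  shows "summable (\<lambda>n. K (int_decode n))"
  by (rule summable_on_imp_summable)
     (use assms summable_on_reindex_bij_betw[of int_decode UNIV UNIV K] bij_int_decode in simp)

lemma summable_on_norm_le:
  fixes f :: "int \<Rightarrow> complex"
  assumes "K summable_on UNIV" "\<And>k. norm (f k) \<le> K k"
  shows "f summable_on UNIV"
  by (rule abs_summable_summable, rule Infinite_Sum.abs_summable_on_comparison_test'[of K]) (use assms in auto)

lemma infsum_diff_complex:
  fixes f g :: "int \<Rightarrow> complex"
  assumes "f summable_on UNIV" "g summable_on UNIV"
  shows "(\<Sum>\<^sub>\<infinity>k. f k - g k) = infsum f UNIV - infsum g UNIV"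
  using infsum_add[OF assms(1) summable_on_uminus[THEN iffD2, OF assms(2)]] by (simp add: infsum_uminus)

lemma infsum_int_shift:
  fixes f :: "int \<Rightarrow> complex"
  shows "infsum (\<lambda>k. f (k + 1)) UNIV = infsum f UNIV"
  by (rule infsum_reindex_bij_betw) (rule bij_betwI[of _ _ _ "\<lambda>k. k - 1"], auto)

lemma summable_on_int_shift:
  fixes f :: "int \<Rightarrow> complex"
  shows "(\<lambda>k. f (k + 1)) summable_on UNIV \<longleftrightarrow> f summable_on UNIV"
  by (rule summable_on_reindex_bij_betw) (rule bij_betwI[of _ _ _ "\<lambda>k. k - 1"], auto)

section \<open>The weight and its Gaussian decay\<close>

text \<open>
  The factor of the weight that belongs to one parameter \<open>t\<close>. It would be a theta function of \<open>z\<close>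
  for \<open>t\<^sup>2 = -1/q\<close>.
\<close>

definition theta_pair :: "complex \<Rightarrow> complex \<Rightarrow> complex \<Rightarrow> complex" where
  "theta_pair t q z = qpoch_inf (- (q * z * t)) q * qpoch_inf (q * t / z) q"

definition weight :: "complex \<Rightarrow> complex \<Rightarrow> complex \<Rightarrow> complex \<Rightarrow> complex \<Rightarrow> int \<Rightarrow> complex" where
  "weight a b c q \<beta> k = (let z = q powi k * \<beta> in
     (1 + z\<^sup>2) * (theta_pair a q z * theta_pair b q z * theta_pair c q z) *
     (q powi (2 * k\<^sup>2 - k) * \<beta> powi (4 * k)))"

text \<open>
  Majorants that are uniform in the parameters and in \<open>\<beta>\<close>: \<open>r = |q|\<close>, \<open>N = |k|\<close>, \<open>B\<close> bounds \<open>|\<beta>|\<close>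
  and \<open>|1/\<beta>|\<close>, and \<open>A\<close> bounds \<open>B\<close> times each parameter. Uniformity is needed twice, for the limit
  \<open>a \<rightarrow> 0\<close> and for integrating over \<open>\<beta> = q\<^sup>x\<alpha>\<close>.
\<close>

definition pair_bound :: "real \<Rightarrow> real \<Rightarrow> nat \<Rightarrow> real" where
  "pair_bound r A N = exp (A / (1 - r)) ^ 2 * (\<Prod>j<N. 1 + A / r ^ Suc j)"

definition weight_bound :: "real \<Rightarrow> real \<Rightarrow> real \<Rightarrow> nat \<Rightarrow> real" where
  "weight_bound r A B N = 2 * B\<^sup>2 * pair_bound r A N ^ 3 * r ^ (2 * N\<^sup>2) * (B ^ 4 / r ^ 3) ^ N"

lemma norm_qpoch_inf_neg_power_le:
  assumes q: "0 < norm q" "norm q < 1" and u: "norm u \<le> A"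
  shows "norm (qpoch_inf (u / q ^ N) q) \<le> exp (A / (1 - norm q)) * (\<Prod>j<N. 1 + A / norm q ^ Suc j)"
proof -
  have q0: "q \<noteq> 0" using q by auto
  have A: "A \<ge> 0" using u norm_ge_zero order_trans by blast
  have "qpoch_inf (u / q ^ N) q = qpoch (u / q ^ N) q N * qpoch_inf u q"
    using qpoch_inf_split[OF q(2), of "u / q ^ N" N] q0 by simp
  moreover have "norm (qpoch (u / q ^ N) q N) \<le> (\<Prod>j<N. 1 + A / norm q ^ Suc j)"
  proof -
    have "norm (qpoch (u / q ^ N) q N) = (\<Prod>j<N. norm (1 - u / q ^ N * q ^ j))"
      by (simp add: qpoch_def prod_norm)
    also have "\<dots> = (\<Prod>j<N. norm (1 - u / q ^ Suc j))"
    proof -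
      have "(\<Prod>j<N. norm (1 - u / q ^ N * q ^ (N - Suc j))) = (\<Prod>j<N. norm (1 - u / q ^ N * q ^ j))"
        by (rule prod.nat_diff_reindex)
      moreover have "u / q ^ N * q ^ (N - Suc j) = u / q ^ Suc j" if "j < N" for j
      proof -
        have "q ^ N = q ^ (N - Suc j) * q ^ Suc j"
          using that by (simp del: power_Suc flip: power_add)
        then show ?thesis using q0 by simp
      qed
      ultimately show ?thesis by (metis (no_types, lifting) lessThan_iff prod.cong)
    qed
    also have "\<dots> \<le> (\<Prod>j<N. 1 + A / norm q ^ Suc j)"
    proof (intro prod_mono conjI)
      fix j
      have "norm (1 - u / q ^ Suc j) \<le> 1 + norm (u / q ^ Suc j)"
        using norm_triangle_ineq4[of 1 "u / q ^ Suc j"] by simp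
      also have "norm (u / q ^ Suc j) = norm u / norm q ^ Suc j"
        by (simp add: norm_divide norm_power norm_mult)
      also have "\<dots> \<le> A / norm q ^ Suc j"
        using u by (intro divide_right_mono) auto
      finally show "norm (1 - u / q ^ Suc j) \<le> 1 + A / norm q ^ Suc j" by simp
    qed auto
    finally show ?thesis .
  qed
  moreover have "norm (qpoch_inf u q) \<le> exp (A / (1 - norm q))"
    by (rule norm_qpoch_inf_le[OF q(2) u])
  ultimately show ?thesis
    by (simp only: norm_mult mult.commute[of "exp _"]) (intro mult_mono prod_nonneg, auto intro!: add_nonneg_nonneg divide_nonneg_nonneg A)
qed

text \<open>
  Of the two infinite products, the one whose argument carries \<open>q\<^bsup>|k|\<^esup>\<close> stays bounded. The other
  one grows like \<open>r\<^bsup>-k\<^sup>2/2\<^esup>\<close>, and only this single growing factor enters the bound.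
\<close>

lemma norm_pair_le:
  assumes q: "0 < norm q" "norm q < 1" and u: "norm u \<le> A" and v: "norm v \<le> A"
  shows "norm (qpoch_inf (u * q powi k) q * qpoch_inf (v * q powi (- k)) q)
    \<le> pair_bound (norm q) A (nat \<bar>k\<bar>)"
proof -
  have q0: "q \<noteq> 0" using q by auto
  have A: "A \<ge> 0" using u norm_ge_zero order_trans by blast
  have *: "norm (qpoch_inf (u * q ^ N) q * qpoch_inf (v / q ^ N) q) \<le> pair_bound (norm q) A N"
    if "norm u \<le> A" "norm v \<le> A" for u v N
  proof -
    have "norm (u * q ^ N) \<le> norm u"
      using q power_le_one[of "norm q" N] by (simp add: norm_mult norm_power mult_left_le)
    then have "norm (qpoch_inf (u * q ^ N) q) \<le> exp (A / (1 - norm q))"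
      using that by (intro norm_qpoch_inf_le q) auto
    then show ?thesis
      using norm_qpoch_inf_neg_power_le[OF q that(2), of N]
      unfolding norm_mult pair_bound_def power2_eq_square mult.assoc
      by (intro mult_mono) auto
  qed
  show ?thesis
  proof (cases "k \<ge> 0")
    case True
    then obtain N where k: "k = int N" using nonneg_int_cases by blast
    show ?thesis
      using *[OF u v, of N] by (simp add: k power_int_minus divide_inverse)
  next
    case False
    then obtain N where k: "k = - int N" by (metis int_cases2 nle_le of_nat_0_le_iff)
    show ?thesis
      using *[OF v u, of N] by (simp add: k power_int_minus divide_inverse mult.commute)
  qed
qed

lemma pair_bound_nonneg: "0 < r \<Longrightarrow> 0 \<le> A \<Longrightarrow> 0 \<le> pair_bound r A N"
  unfolding pair_bound_def by (intro mult_nonneg_nonneg prod_nonneg) auto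

lemma weight_bound_nonneg: "0 < r \<Longrightarrow> 0 \<le> A \<Longrightarrow> 0 \<le> B \<Longrightarrow> 0 \<le> weight_bound r A B N"
  unfolding weight_bound_def by (intro mult_nonneg_nonneg) (auto intro: pair_bound_nonneg)

text \<open>
  Three pairs grow like \<open>r\<^bsup>-3N\<^sup>2/2\<^esup>\<close> together, which the factor \<open>r\<^bsup>2N\<^sup>2\<^esup>\<close> overcompensates. In terms of
  the ratio test, the quotient of consecutive terms is \<open>(r\<^bsup>N+1\<^esup> + A)\<^sup>3 r\<^sup>N\<close> times a constant.
\<close>

lemma summable_weight_bound:
  assumes r: "0 < r" "r < 1" and A: "0 \<le> A" and B: "0 \<le> B"
  shows "summable (weight_bound r A B)"
proof -
  (* Of the powers of r, r^(4N+2) comes from r^(2N^2), r^(-3) from B^4 / r^3, and r^(-3(N+1)) from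
     the three denominators r^(N+1) in 1 + A / r^(N+1). *)
  define \<rho> where "\<rho> N = (r ^ Suc N + A) ^ 3 * r ^ N * (B ^ 4 / r ^ 4)" for N
  have ratio: "weight_bound r A B (Suc N) = \<rho> N * weight_bound r A B N" for N
  proof -
    have p: "pair_bound r A (Suc N) = pair_bound r A N * ((r ^ Suc N + A) / r ^ Suc N)"
      using r by (simp add: pair_bound_def field_simps)
    have e: "r ^ (2 * (Suc N)\<^sup>2) = r ^ (2 * N\<^sup>2) * (r ^ N * (r ^ Suc N) ^ 3 / r)"
    proof -
      have "r * r ^ (2 * (Suc N)\<^sup>2) = r ^ (2 * N\<^sup>2 + (N + Suc N * 3))"
      proof -
        have "Suc (2 * (Suc N)\<^sup>2) = 2 * N\<^sup>2 + (N + Suc N * 3)"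
          by (simp add: power2_eq_square)
        then show ?thesis by (metis power_Suc)
      qed
      then have "r * r ^ (2 * (Suc N)\<^sup>2) = r ^ (2 * N\<^sup>2) * (r ^ N * (r ^ Suc N) ^ 3)"
        by (simp only: power_add power_mult)
      then show ?thesis using r
        by (metis nonzero_mult_div_cancel_left less_irrefl times_divide_eq_right)
    qed
    have "K * (X * (Y / Z)) ^ 3 * (R * (W * Z ^ 3 / r)) * (B ^ 4 / r ^ 3 * E) =
        Y ^ 3 * W * (B ^ 4 / r ^ 4) * (K * X ^ 3 * R * E)" if "Z \<noteq> 0" for K X Y Z R W E :: real
    proof -
      have "(X * (Y / Z)) ^ 3 * Z ^ 3 = X ^ 3 * Y ^ 3"
        unfolding power_mult_distrib[symmetric] using that by simp
      moreover have "r ^ 4 = r ^ 3 * r" by (simp add: power3_eq_cube eval_nat_numeral)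
      ultimately show ?thesis using r that by (simp add: field_simps)
    qed
    moreover have "r ^ Suc N \<noteq> 0" using r by simp
    ultimately show ?thesis
      unfolding weight_bound_def p e power_Suc[of "B ^ 4 / r ^ 3"] \<rho>_def by blast
  qed
  have r0: "(\<lambda>N. r ^ N) \<longlonglongrightarrow> 0" using r by (intro LIMSEQ_power_zero) auto
  have "\<rho> \<longlonglongrightarrow> (0 + A) ^ 3 * 0 * (B ^ 4 / r ^ 4)"
    unfolding \<rho>_def
    by (rule tendsto_mult[OF tendsto_mult[OF tendsto_power[OF
      tendsto_add[OF LIMSEQ_Suc[OF r0] tendsto_const]] r0] tendsto_const])
  then have "\<forall>\<^sub>F N in sequentially. \<rho> N < 1 / 2"
    by (intro order_tendstoD(2)) auto
  then obtain M where M: "\<And>N. N \<ge> M \<Longrightarrow> \<rho> N < 1 / 2"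
    by (auto simp: eventually_sequentially)
  show ?thesis
  proof (rule summable_ratio_test[of "1 / 2" M])
    fix N assume "N \<ge> M"
    have wn: "weight_bound r A B k \<ge> 0" for k by (rule weight_bound_nonneg) (use r A B in auto)
    have "\<rho> N * weight_bound r A B N \<le> 1 / 2 * weight_bound r A B N"
      by (rule mult_right_mono) (use M[OF \<open>N \<ge> M\<close>] wn in auto)
    then show "norm (weight_bound r A B (Suc N)) \<le> 1 / 2 * norm (weight_bound r A B N)"
      unfolding real_norm_def abs_of_nonneg[OF wn] by (simp only: ratio)
  qed auto
qed

lemma weight_bound_summable_on:
  assumes "0 < r" "r < 1" "0 \<le> A" "0 \<le> B"
  shows "(\<lambda>k::int. weight_bound r A B (nat \<bar>k\<bar>)) summable_on UNIV"
  by (rule summable_on_nat_abs) (use assms in \<open>auto intro: summable_weight_bound weight_bound_nonneg\<close>)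

lemma norm_power_int_le:
  fixes x :: complex
  assumes "norm x \<le> D" "norm (inverse x) \<le> D"
  shows "norm (x powi k) \<le> D ^ nat \<bar>k\<bar>"
proof (cases "k \<ge> 0")
  case True
  then show ?thesis using assms by (simp add: power_int_def norm_power power_mono)
next
  case False
  then show ?thesis using assms by (simp add: power_int_def norm_power power_mono)
qed

text \<open>
  Stated for a free factor \<open>f\<close> and free products \<open>p1, p2, p3\<close> because it serves two sequences:
  the weight, where \<open>f\<close> is \<open>1 + z\<^sup>2\<close>, and the telescoping sequence \<open>boundary\<close>, where \<open>f\<close> is \<open>1/z\<close>.
\<close>

lemma norm_weight_like_le:
  fixes q \<beta> f p1 p2 p3 :: complex
  assumes q: "0 < norm q" "norm q < 1"
    and \<beta>: "\<beta> \<noteq> 0" "norm \<beta> \<le> B" "norm (1 / \<beta>) \<le> B"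
    and A: "0 \<le> A"
    and f: "norm f \<le> 2 * B\<^sup>2 * (1 / norm q ^ 2) ^ nat \<bar>k\<bar>"
    and p: "norm p1 \<le> pair_bound (norm q) A (nat \<bar>k\<bar>)" "norm p2 \<le> pair_bound (norm q) A (nat \<bar>k\<bar>)"
      "norm p3 \<le> pair_bound (norm q) A (nat \<bar>k\<bar>)"
  shows "norm (f * (p1 * p2 * p3) * (q powi (2 * k\<^sup>2 - k) * \<beta> powi (4 * k)))
    \<le> weight_bound (norm q) A B (nat \<bar>k\<bar>)"
proof -
  define r where "r = norm q"
  define N where "N = nat \<bar>k\<bar>"
  define P where "P = pair_bound r A N"
  have q0: "q \<noteq> 0" using q by auto
  have r: "0 < r" "r < 1" using q by (auto simp: r_def)
  have B0: "0 \<le> B" using \<beta>(2) norm_ge_zero order_trans by blast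
  have P0: "0 \<le> P" unfolding P_def by (intro pair_bound_nonneg r A)
  have "norm (q powi (2 * k\<^sup>2 - k)) \<le> r ^ (2 * N\<^sup>2) * (1 / r) ^ N"
  proof -
    have k2: "2 * k\<^sup>2 = int (2 * N\<^sup>2)" by (simp add: N_def)
    have "q powi (2 * k\<^sup>2 - k) = q ^ (2 * N\<^sup>2) * q powi (- k)"
      using q0 unfolding k2 power_int_diff[of q, OF disjI1, OF q0] power_int_of_nat
      by (simp add: power_int_minus divide_inverse)
    moreover have "norm (q powi (- k)) \<le> (1 / r) ^ nat \<bar>- k\<bar>"
    proof (rule norm_power_int_le)
      have "1 \<le> 1 / r" using r by simp
      then show "norm q \<le> 1 / r" using r unfolding r_def by linarith
      show "norm (inverse q) \<le> 1 / r" by (simp add: r_def norm_inverse inverse_eq_divide norm_divide)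
    qed
    ultimately show ?thesis using r by (simp add: norm_mult norm_power r_def N_def mult_left_mono)
  qed
  moreover have "norm (\<beta> powi (4 * k)) \<le> (B ^ 4) ^ N"
  proof -
    have "norm (\<beta> powi (4 * k)) \<le> B ^ nat \<bar>4 * k\<bar>"
      using \<beta> by (intro norm_power_int_le) (auto simp: inverse_eq_divide)
    also have "nat \<bar>4 * k\<bar> = 4 * N" by (simp add: N_def nat_mult_distrib abs_mult)
    finally show ?thesis by (simp add: power_mult)
  qed
  ultimately have "norm (q powi (2 * k\<^sup>2 - k) * \<beta> powi (4 * k)) \<le> (r ^ (2 * N\<^sup>2) * (1 / r) ^ N) * (B ^ 4) ^ N"
    unfolding norm_mult using r by (intro mult_mono) auto
  moreover have "norm (f * (p1 * p2 * p3)) \<le> 2 * B\<^sup>2 * (1 / r ^ 2) ^ N * (P * P * P)"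
    using f p P0 B0 unfolding norm_mult r_def[symmetric] N_def[symmetric] P_def[symmetric]
    by (intro mult_mono mult_nonneg_nonneg) auto
  ultimately have "norm (f * (p1 * p2 * p3) * (q powi (2 * k\<^sup>2 - k) * \<beta> powi (4 * k))) \<le>
      2 * B\<^sup>2 * (1 / r ^ 2) ^ N * (P * P * P) * ((r ^ (2 * N\<^sup>2) * (1 / r) ^ N) * (B ^ 4) ^ N)"
    unfolding norm_mult[of "f * (p1 * p2 * p3)"] using P0 B0 r by (intro mult_mono) auto
  also have "\<dots> = weight_bound r A B N"
  proof -
    have "(B ^ 4 / r ^ 3) ^ N = (1 / r ^ 2) ^ N * (1 / r) ^ N * (B ^ 4) ^ N"
      unfolding power_mult_distrib[symmetric] by (simp add: power2_eq_square power3_eq_cube)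
    then show ?thesis
      unfolding weight_bound_def P_def[symmetric] by (simp add: power3_eq_cube mult_ac)
  qed
  finally show ?thesis by (simp add: r_def N_def)
qed


text \<open>
  Replacing \<open>t\<close> by \<open>t/q\<close> multiplies the pair by \<open>1 - t\<^sup>2 + t (z - 1/z)\<close>. This is linear in
  \<open>z - 1/z\<close>, which is why polynomials in \<open>z - 1/z\<close> act on the weight by shifting a parameter.
\<close>

lemma theta_pair_div:
  assumes "norm q < 1" "q \<noteq> 0" "z \<noteq> 0"
  shows "theta_pair (t / q) q z = (1 + z * t) * (1 - t / z) * theta_pair t q z"
  using assms qpoch_inf_step[OF assms(1), of "- (z * t)"] qpoch_inf_step[OF assms(1), of "t / z"]
  by (simp add: theta_pair_def mult_ac)

lemma theta_pair_0 [simp]: "theta_pair 0 q z = 1"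
  by (simp add: theta_pair_def)

lemma norm_theta_pair_le:
  assumes q: "0 < norm q" "norm q < 1"
    and \<beta>: "norm \<beta> \<le> B" "norm (1 / \<beta>) \<le> B" and t: "B * norm t \<le> A"
  shows "norm (theta_pair t q (q powi k * \<beta>)) \<le> pair_bound (norm q) A (nat \<bar>k\<bar>)"
proof -
  have B0: "0 \<le> B" using \<beta>(1) norm_ge_zero order_trans by blast
  have "norm q * (norm \<beta> * norm t) \<le> 1 * (B * norm t)"
    using q \<beta> B0 by (intro mult_mono) auto
  then have u: "norm (- (q * \<beta> * t)) \<le> A" using t by (simp add: norm_mult mult_ac)
  have "norm q * (norm (1 / \<beta>) * norm t) \<le> 1 * (B * norm t)"
    using q \<beta> B0 by (intro mult_mono) auto
  then have v: "norm (q * t / \<beta>) \<le> A" using t by (simp add: norm_mult norm_divide mult_ac)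
  have "- (q * (q powi k * \<beta>) * t) = - (q * \<beta> * t) * q powi k"
    "q * t / (q powi k * \<beta>) = (q * t / \<beta>) * q powi (- k)"
    by (simp_all add: power_int_minus divide_inverse)
  then show ?thesis
    unfolding theta_pair_def by (simp only:) (rule norm_pair_le[OF q u v])
qed

lemma norm_power_int_mult_le:
  fixes q \<beta> :: complex
  assumes q: "0 < norm q" "norm q < 1" and \<beta>: "\<beta> \<noteq> 0" "norm \<beta> \<le> B" "norm (1 / \<beta>) \<le> B"
  shows "norm (1 + (q powi k * \<beta>)\<^sup>2) \<le> 2 * B\<^sup>2 * (1 / norm q ^ 2) ^ nat \<bar>k\<bar>"
    and "norm (1 / (q powi k * \<beta>)) \<le> 2 * B\<^sup>2 * (1 / norm q ^ 2) ^ nat \<bar>k\<bar>"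
proof -
  define D where "D = (1 / norm q) ^ nat \<bar>k\<bar>"
  have B1: "1 \<le> B"
  proof (rule ccontr)
    assume "\<not> 1 \<le> B"
    then have "norm \<beta> * norm (1 / \<beta>) < 1"
      using \<beta> by (smt (verit) mult_left_le_one_le norm_ge_zero mult_left_le zero_less_norm_iff)
    then show False using \<beta> by (simp add: norm_divide)
  qed
  have q1: "1 \<le> 1 / norm q" using q by simp
  then have D1: "1 \<le> D" unfolding D_def by (rule one_le_power)
  have D2: "(1 / norm q ^ 2) ^ nat \<bar>k\<bar> = D ^ 2"
    by (simp add: D_def power_divide power_mult[symmetric] mult.commute)
  have qk: "norm (q powi k) \<le> D" "norm (q powi (- k)) \<le> D"
    using norm_power_int_le[of q "1 / norm q" k] norm_power_int_le[of q "1 / norm q" "- k"] q q1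
    by (simp_all add: D_def norm_inverse inverse_eq_divide norm_divide)
  have "norm (q powi k * \<beta>) \<le> D * B"
    unfolding norm_mult using qk \<beta> D1 by (intro mult_mono) auto
  then have "norm ((q powi k * \<beta>)\<^sup>2) \<le> (D * B)\<^sup>2"
    unfolding norm_power by (rule power_mono) simp
  moreover have DB: "1 \<le> D * B" using D1 B1 mult_mono[of 1 D 1 B] by simp
  moreover have "1 \<le> (D * B)\<^sup>2" using DB by (rule one_le_power)
  ultimately show "norm (1 + (q powi k * \<beta>)\<^sup>2) \<le> 2 * B\<^sup>2 * (1 / norm q ^ 2) ^ nat \<bar>k\<bar>"
    using norm_triangle_ineq[of 1 "(q powi k * \<beta>)\<^sup>2"] unfolding D2
    by (simp add: power_mult_distrib mult_ac)
  have "1 / (q powi k * \<beta>) = q powi (- k) * (1 / \<beta>)"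
    by (simp add: power_int_minus divide_inverse)
  then have "norm (1 / (q powi k * \<beta>)) \<le> D * B"
    unfolding norm_mult using qk \<beta> D1 by (simp only: norm_mult) (intro mult_mono, auto)
  also have "\<dots> \<le> (D * B)\<^sup>2"
    using mult_left_mono[OF DB, of "D * B"] DB by (simp add: power2_eq_square)
  finally show "norm (1 / (q powi k * \<beta>)) \<le> 2 * B\<^sup>2 * (1 / norm q ^ 2) ^ nat \<bar>k\<bar>"
    unfolding D2 using B1 D1 \<open>1 \<le> (D * B)\<^sup>2\<close> by (simp add: power_mult_distrib mult_ac)
qed

lemma norm_weight_le:
  assumes q: "0 < norm q" "norm q < 1"
    and \<beta>: "\<beta> \<noteq> 0" "norm \<beta> \<le> B" "norm (1 / \<beta>) \<le> B"
    and A: "0 \<le> A" "B * norm a \<le> A" "B * norm b \<le> A" "B * norm c \<le> A"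
  shows "norm (weight a b c q \<beta> k) \<le> weight_bound (norm q) A B (nat \<bar>k\<bar>)"
  unfolding weight_def Let_def
  by (intro norm_weight_like_le norm_theta_pair_le[where B = B] norm_power_int_mult_le assms)

lemma obtain_bounds:
  fixes \<beta> a b c :: complex
  obtains A B where "0 \<le> B" "norm \<beta> \<le> B" "norm (1 / \<beta>) \<le> B"
    "0 \<le> A" "B * norm a \<le> A" "B * norm b \<le> A" "B * norm c \<le> A"
proof -
  define B where "B = max (norm \<beta>) (norm (1 / \<beta>))"
  have "0 \<le> B" "norm \<beta> \<le> B" "norm (1 / \<beta>) \<le> B"
    unfolding B_def by (simp_all only: max.cobounded1 max.cobounded2 le_max_iff_disj norm_ge_zero simp_thms)
  then show ?thesis
    by (intro that[of B "B * norm a + B * norm b + B * norm c"]) auto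
qed

lemma weight_summable:
  assumes q: "0 < norm q" "norm q < 1" and \<beta>: "\<beta> \<noteq> 0"
  shows "weight a b c q \<beta> summable_on UNIV"
proof -
  obtain A B where B: "0 \<le> B" "norm \<beta> \<le> B" "norm (1 / \<beta>) \<le> B"
    and A: "0 \<le> A" "B * norm a \<le> A" "B * norm b \<le> A" "B * norm c \<le> A"
    by (rule obtain_bounds)
  show ?thesis
    by (rule summable_on_norm_le[OF weight_bound_summable_on[OF q A(1) B(1)]
        norm_weight_le[OF q \<beta> B(2,3) A]])
qed

section \<open>Evaluation of the total mass\<close>

definition mass :: "complex \<Rightarrow> complex \<Rightarrow> complex \<Rightarrow> complex \<Rightarrow> complex \<Rightarrow> complex" where
  "mass a b c q \<beta> = (\<Sum>\<^sub>\<infinity>k\<in>UNIV. weight a b c q \<beta> k)"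

text \<open>
  The sequence whose differences telescope in \<open>mass_contiguous\<close>. Compared with the weight, the
  shifts by \<open>q\<close> in \<open>(-qzt; q)\<^sub>\<infinity>\<close> are removed, so that its values at \<open>k\<close> and \<open>k + 1\<close> are Laurent
  polynomials in \<open>z\<close> times the same products.
\<close>

definition boundary :: "complex \<Rightarrow> complex \<Rightarrow> complex \<Rightarrow> complex \<Rightarrow> complex \<Rightarrow> int \<Rightarrow> complex" where
  "boundary a b c q \<beta> k = (let z = q powi k * \<beta>; g = (\<lambda>t. qpoch_inf (- (z * t)) q * qpoch_inf (q * t / z) q) in
     1 / z * (g a * g b * g c) * (q powi (2 * k\<^sup>2 - k) * \<beta> powi (4 * k)))"

lemma boundary_summable:
  assumes q: "0 < norm q" "norm q < 1" and \<beta>: "\<beta> \<noteq> 0"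
  shows "boundary a b c q \<beta> summable_on UNIV"
proof -
  obtain A B where B: "0 \<le> B" "norm \<beta> \<le> B" "norm (1 / \<beta>) \<le> B"
    and A: "0 \<le> A" "B * norm a \<le> A" "B * norm b \<le> A" "B * norm c \<le> A"
    by (rule obtain_bounds)
  have g: "norm (qpoch_inf (- (q powi k * \<beta> * t)) q * qpoch_inf (q * t / (q powi k * \<beta>)) q)
      \<le> pair_bound (norm q) A (nat \<bar>k\<bar>)" if "B * norm t \<le> A" for t k
  proof -
    have "norm \<beta> * norm t \<le> B * norm t"
      using B by (intro mult_right_mono) auto
    then have u: "norm (- (\<beta> * t)) \<le> A" using that by (simp add: norm_mult)
    have "norm q * (norm (1 / \<beta>) * norm t) \<le> 1 * (B * norm t)"
      using q B by (intro mult_mono) auto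
    then have v: "norm (q * t / \<beta>) \<le> A" using that by (simp add: norm_mult norm_divide mult_ac)
    have "- (q powi k * \<beta> * t) = - (\<beta> * t) * q powi k"
      "q * t / (q powi k * \<beta>) = (q * t / \<beta>) * q powi (- k)"
      by (simp_all add: power_int_minus divide_inverse)
    then show ?thesis by (simp only:) (rule norm_pair_le[OF q u v])
  qed
  have "norm (boundary a b c q \<beta> k) \<le> weight_bound (norm q) A B (nat \<bar>k\<bar>)" for k
    unfolding boundary_def Let_def
    by (intro norm_weight_like_le g norm_power_int_mult_le q \<beta> B A)
  from summable_on_norm_le[OF weight_bound_summable_on[OF q A(1) B(1)] this] show ?thesis .
qed

text \<open>
  After division by the common products this is an identity of Laurent polynomials in \<open>z\<close>, where
  the difference of \<open>z\<^sup>4 (1-a/z)(1-b/z)(1-c/z)\<close> and \<open>(1+za)(1+zb)(1+zc)\<close> turns out to be divisible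
  by \<open>1 + z\<^sup>2\<close>.
\<close>

lemma boundary_difference:
  assumes q: "0 < norm q" "norm q < 1" and \<beta>: "\<beta> \<noteq> 0"
  shows "a * (boundary a b c q \<beta> (k + 1) - boundary a b c q \<beta> k) =
    weight (a / q) b c q \<beta> k - (1 + a * b) * (1 + a * c) * weight a b c q \<beta> k"
proof -
  define z where "z = q powi k * \<beta>"
  define Q where "Q = q powi (2 * k\<^sup>2 - k) * \<beta> powi (4 * k)"
  define G where "G = theta_pair a q z * theta_pair b q z * theta_pair c q z"
  have q0: "q \<noteq> 0" using q by auto
  have z0: "z \<noteq> 0" using q0 \<beta> by (simp add: z_def)
  have s: "qpoch_inf (- (z * t)) q * qpoch_inf (q * t / z) q = (1 + z * t) * theta_pair t q z" for t
    using qpoch_inf_step[OF q(2), of "- (z * t)"] by (simp add: theta_pair_def mult_ac)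
  have b0: "boundary a b c q \<beta> k = (1 + z * a) * (1 + z * b) * (1 + z * c) / z * G * Q"
    unfolding boundary_def Let_def z_def[symmetric] s Q_def[symmetric] by (simp add: G_def)
  have z1: "q powi (k + 1) * \<beta> = q * z"
    using q0 by (simp add: z_def power_int_add)
  have s1: "qpoch_inf (- (q * z * t)) q * qpoch_inf (q * t / (q * z)) q = (1 - t / z) * theta_pair t q z" for t
    using qpoch_inf_step[OF q(2), of "t / z"] q0 by (simp add: theta_pair_def mult_ac)
  have Q1: "q powi (2 * (k + 1)\<^sup>2 - (k + 1)) * \<beta> powi (4 * (k + 1)) = Q * (q * z ^ 4)"
  proof -
    have "2 * (k + 1)\<^sup>2 - (k + 1) = (2 * k\<^sup>2 - k) + (k * 4 + 1)"
      by (simp add: power2_eq_square algebra_simps)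
    moreover have "q powi (k * 4) = (q powi k) ^ 4"
      by (metis power_int_mult power_int_numeral)
    ultimately have "q powi (2 * (k + 1)\<^sup>2 - (k + 1)) = q powi (2 * k\<^sup>2 - k) * ((q powi k) ^ 4 * q)"
      using q0 by (simp only: power_int_add[of q, OF disjI1, OF q0] power_int_1_right)
    moreover have "\<beta> powi (4 * (k + 1)) = \<beta> powi (4 * k) * \<beta> ^ 4"
      using \<beta> by (simp add: power_int_add distrib_left)
    ultimately show ?thesis
      by (simp add: Q_def z_def power_mult_distrib)
  qed
  have "1 / (q * z) * (((1 - a / z) * ta) * ((1 - b / z) * tb) * ((1 - c / z) * tc)) * (Q * (q * z ^ 4)) =
      z ^ 3 * (1 - a / z) * (1 - b / z) * (1 - c / z) * (ta * tb * tc) * Q" for ta tb tc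
    using q0 z0 by (simp add: power3_eq_cube eval_nat_numeral)
  then have b1: "boundary a b c q \<beta> (k + 1) = z ^ 3 * (1 - a / z) * (1 - b / z) * (1 - c / z) * G * Q"
    unfolding boundary_def Let_def z1 s1 Q1 G_def .
  have w: "weight a b c q \<beta> k = (1 + z\<^sup>2) * G * Q"
    by (simp add: weight_def Let_def G_def z_def Q_def)
  have w1: "weight (a / q) b c q \<beta> k = (1 + z\<^sup>2) * ((1 + z * a) * (1 - a / z) * G) * Q"
    unfolding weight_def Let_def z_def[symmetric] theta_pair_div[OF q(2) q0 z0] G_def Q_def by simp
  have "a * (z ^ 3 * (1 - a / z) * (1 - b / z) * (1 - c / z) - (1 + z * a) * (1 + z * b) * (1 + z * c) / z) =
      (1 + z\<^sup>2) * ((1 + z * a) * (1 - a / z) - (1 + a * b) * (1 + a * c))"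
    using z0 by (simp add: divide_simps) algebra
  then have "a * (z ^ 3 * (1 - a / z) * (1 - b / z) * (1 - c / z) - (1 + z * a) * (1 + z * b) * (1 + z * c) / z) * (G * Q) =
      (1 + z\<^sup>2) * ((1 + z * a) * (1 - a / z) - (1 + a * b) * (1 + a * c)) * (G * Q)" by simp
  then show ?thesis unfolding b0 b1 w w1 by (simp add: algebra_simps)
qed

lemma mass_contiguous:
  assumes q: "0 < norm q" "norm q < 1" and \<beta>: "\<beta> \<noteq> 0"
  shows "mass (a / q) b c q \<beta> = (1 + a * b) * (1 + a * c) * mass a b c q \<beta>"
proof -
  let ?V = "boundary a b c q \<beta>"
  have V: "?V summable_on UNIV" by (rule boundary_summable[OF assms])
  have V': "(\<lambda>k. ?V (k + 1)) summable_on UNIV"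
    using V by (simp add: summable_on_int_shift)
  let ?f = "(1 + a * b) * (1 + a * c)"
  have "(\<Sum>\<^sub>\<infinity>k. a * (?V (k + 1) - ?V k)) = a * ((\<Sum>\<^sub>\<infinity>k. ?V (k + 1)) - (\<Sum>\<^sub>\<infinity>k. ?V k))"
    by (simp only: infsum_cmult_right' infsum_diff_complex[OF V' V])
  also have "\<dots> = 0" by (simp only: infsum_int_shift[of ?V]) simp
  finally have "(\<Sum>\<^sub>\<infinity>k. weight (a / q) b c q \<beta> k - ?f * weight a b c q \<beta> k) = 0"
    by (simp only: boundary_difference[OF assms])
  moreover have "(\<Sum>\<^sub>\<infinity>k. weight (a / q) b c q \<beta> k - ?f * weight a b c q \<beta> k) =
      mass (a / q) b c q \<beta> - (\<Sum>\<^sub>\<infinity>k. ?f * weight a b c q \<beta> k)"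
    unfolding mass_def
    by (rule infsum_diff_complex) (intro summable_on_cmult_right weight_summable assms)+
  ultimately show ?thesis
    by (simp only: infsum_cmult_right' mass_def) simp
qed

lemma mass_iterate:
  assumes q: "0 < norm q" "norm q < 1" and \<beta>: "\<beta> \<noteq> 0"
  shows "mass a b c q \<beta> = qpoch (- (q * a * b)) q N * qpoch (- (q * a * c)) q N * mass (a * q ^ N) b c q \<beta>"
proof (induction N)
  case (Suc N)
  have q0: "q \<noteq> 0" using q by auto
  have "mass (a * q ^ N) b c q \<beta> =
      (1 + q * a * b * q ^ N) * (1 + q * a * c * q ^ N) * mass (a * q ^ Suc N) b c q \<beta>"
    using mass_contiguous[OF assms, of "a * q ^ Suc N" b c] q0 by (simp add: mult_ac)
  with Suc.IH show ?case by (simp add: qpoch_Suc mult_ac)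
qed simp

lemma weight_tendsto_0:
  assumes q: "0 < norm q" "norm q < 1" and \<beta>: "\<beta> \<noteq> 0"
  shows "(\<lambda>N. weight (a * q ^ N) b c q \<beta> k) \<longlonglongrightarrow> weight 0 b c q \<beta> k"
proof -
  have qN: "(\<lambda>N. q ^ N) \<longlonglongrightarrow> 0" using q by (intro LIMSEQ_power_zero) auto
  have "(\<lambda>N. theta_pair (a * q ^ N) q z) \<longlonglongrightarrow> theta_pair 0 q z" for z
  proof -
    have "(\<lambda>N. - (q * z * (a * q ^ N))) \<longlonglongrightarrow> - (q * z * (a * 0))"
      by (intro tendsto_intros qN)
    moreover have "(\<lambda>N. (q / z) * (a * q ^ N)) \<longlonglongrightarrow> (q / z) * (a * 0)"
      by (intro tendsto_intros qN)
    ultimately have "(\<lambda>N. qpoch_inf (- (q * z * (a * q ^ N))) q * qpoch_inf ((q / z) * (a * q ^ N)) q) \<longlonglongrightarrow> 1 * 1"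
      by (intro tendsto_mult tendsto_qpoch_inf_1 q) auto
    then show ?thesis by (simp add: theta_pair_def)
  qed
  then show ?thesis unfolding weight_def Let_def by (intro tendsto_intros)
qed

text \<open>
  Tannery's theorem applies because multiplying \<open>a\<close> by \<open>q\<^sup>N\<close> does not increase its modulus, so one
  majorant serves for all \<open>N\<close>.
\<close>

lemma mass_tendsto_0:
  assumes q: "0 < norm q" "norm q < 1" and \<beta>: "\<beta> \<noteq> 0"
  shows "(\<lambda>N. mass (a * q ^ N) b c q \<beta>) \<longlonglongrightarrow> mass 0 b c q \<beta>"
proof -
  obtain A B where B: "0 \<le> B" "norm \<beta> \<le> B" "norm (1 / \<beta>) \<le> B"
    and A: "0 \<le> A" "B * norm a \<le> A" "B * norm b \<le> A" "B * norm c \<le> A"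
    by (rule obtain_bounds)
  let ?K = "\<lambda>k. weight_bound (norm q) A B (nat \<bar>k\<bar>)"
  have K: "?K summable_on UNIV"
    by (rule weight_bound_summable_on[OF q A(1) B(1)])
  have bound: "norm (weight (a * q ^ N) b c q \<beta> k) \<le> ?K k" for N k
  proof (intro norm_weight_le q \<beta> B A)
    have "norm a * norm q ^ N \<le> norm a * 1"
      using q by (intro mult_left_mono power_le_one) auto
    then have "B * norm (a * q ^ N) \<le> B * norm a"
      using B(1) by (intro mult_left_mono) (auto simp: norm_mult norm_power)
    then show "B * norm (a * q ^ N) \<le> A" using A(2) by linarith
  qed
  have "(\<lambda>N. \<Sum>n. weight (a * q ^ N) b c q \<beta> (int_decode n)) \<longlonglongrightarrow> (\<Sum>n. weight 0 b c q \<beta> (int_decode n))"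
    by (rule tannerys_theorem[where M = "\<lambda>n. ?K (int_decode n)", THEN conjunct2, THEN conjunct2])
       (use bound summable_on_int_imp_summable[OF K] in
         \<open>auto intro!: weight_tendsto_0 assms always_eventually\<close>)
  then show ?thesis
    unfolding mass_def
    using infsum_int_eq_suminf[OF weight_summable[OF assms], THEN sums_unique] by simp
qed

lemma mass_reduce:
  assumes q: "0 < norm q" "norm q < 1" and \<beta>: "\<beta> \<noteq> 0"
  shows "mass a b c q \<beta> = qpoch_inf (- (q * a * b)) q * qpoch_inf (- (q * a * c)) q * mass 0 b c q \<beta>"
proof (rule LIMSEQ_unique)
  show "(\<lambda>N. mass a b c q \<beta>) \<longlonglongrightarrow> mass a b c q \<beta>" by simp
  have "(\<lambda>N. qpoch (- (q * a * b)) q N * qpoch (- (q * a * c)) q N * mass (a * q ^ N) b c q \<beta>)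
    \<longlonglongrightarrow> qpoch_inf (- (q * a * b)) q * qpoch_inf (- (q * a * c)) q * mass 0 b c q \<beta>"
    by (intro tendsto_intros qpoch_tendsto_qpoch_inf mass_tendsto_0 assms)
  then show "(\<lambda>N. mass a b c q \<beta>)
    \<longlonglongrightarrow> qpoch_inf (- (q * a * b)) q * qpoch_inf (- (q * a * c)) q * mass 0 b c q \<beta>"
    by (simp only: mass_iterate[OF assms, symmetric])
qed

lemma mass_perm: "mass a b c q \<beta> = mass b a c q \<beta>" "mass a b c q \<beta> = mass c b a q \<beta>"
  by (simp_all add: mass_def weight_def Let_def mult_ac)

lemma mass_eq_mass_000:
  assumes q: "0 < norm q" "norm q < 1" and \<beta>: "\<beta> \<noteq> 0"
  shows "mass a b c q \<beta> = qpoch_inf (- (q * a * b)) q * qpoch_inf (- (q * a * c)) q *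
    qpoch_inf (- (q * b * c)) q * mass 0 0 0 q \<beta>"
proof -
  have "mass 0 b c q \<beta> = qpoch_inf (- (q * b * c)) q * mass 0 0 c q \<beta>"
    using mass_reduce[OF assms, of b 0 c] mass_perm(1)[of 0 b c q \<beta>] by simp
  moreover have "mass 0 0 c q \<beta> = mass 0 0 0 q \<beta>"
    using mass_reduce[OF assms, of c 0 0] mass_perm(2)[of 0 0 c q \<beta>] by simp
  ultimately show ?thesis using mass_reduce[OF assms, of a b c] by simp
qed

text \<open>
  For \<open>a = \<beta>\<close> the factor \<open>(q\<^bsup>1-k\<^esup>a/\<beta>; q)\<^sub>\<infinity>\<close> vanishes for \<open>k \<ge> 1\<close>, and for \<open>b = -1/\<beta>\<close> the factor
  \<open>(-q\<^bsup>k+1\<^esup>\<beta>b; q)\<^sub>\<infinity>\<close> vanishes for \<open>k \<le> -1\<close>. The bilateral sum thus collapses to a single product,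
  while \<open>mass_eq_mass_000\<close> says that it equals \<open>(q; q)\<^sub>\<infinity>\<close> times the mass sought.
\<close>

lemma mass_000:
  assumes q: "0 < norm q" "norm q < 1" and \<beta>: "\<beta> \<noteq> 0"
  shows "mass 0 0 0 q \<beta> = qpoch_inf q q * qpoch_inf (- \<beta>\<^sup>2) q * qpoch_inf (- (q / \<beta>\<^sup>2)) q"
proof -
  have q0: "q \<noteq> 0" using q by auto
  have vanish: "weight \<beta> (- 1 / \<beta>) 0 q \<beta> k = 0" if "k \<noteq> 0" for k
  proof (cases "k > 0")
    case True
    then obtain j where k: "k = int (Suc j)"
      by (intro that[of "nat (k - 1)"]) simp
    have "qpoch_inf (q * \<beta> / (q powi k * \<beta>)) q = 0"
      by (rule qpoch_inf_eq_0[OF q(2), of _ j]) (use q0 \<beta> in \<open>simp add: k power_int_add\<close>)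
    then show ?thesis by (simp add: weight_def theta_pair_def)
  next
    case False
    then obtain j where k: "k = - int (Suc j)"
      using \<open>k \<noteq> 0\<close> by (intro that[of "nat (- k - 1)"]) simp
    have qk: "q powi k = 1 / q ^ Suc j"
      unfolding k power_int_minus power_int_of_nat by (simp add: inverse_eq_divide)
    have "qpoch_inf (- (q * (q powi k * \<beta>) * (- 1 / \<beta>))) q = 0"
      by (rule qpoch_inf_eq_0[OF q(2), of _ j])
         (use q0 \<beta> in \<open>simp add: qk field_simps\<close>)
    then show ?thesis by (simp add: weight_def theta_pair_def)
  qed
  have "mass \<beta> (- 1 / \<beta>) 0 q \<beta> = infsum (weight \<beta> (- 1 / \<beta>) 0 q \<beta>) {0}"
    unfolding mass_def by (rule infsum_cong_neutral) (use vanish in auto)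
  also have "\<dots> = (1 + \<beta>\<^sup>2) * qpoch_inf (- \<beta>\<^sup>2 * q) q * qpoch_inf q q * qpoch_inf q q * qpoch_inf (- (q / \<beta>\<^sup>2)) q"
    using \<beta> by (simp add: weight_def theta_pair_def power2_eq_square mult_ac)
  also have "(1 + \<beta>\<^sup>2) * qpoch_inf (- \<beta>\<^sup>2 * q) q = qpoch_inf (- \<beta>\<^sup>2) q"
    using qpoch_inf_step[OF q(2), of "- \<beta>\<^sup>2"] by simp
  finally have "mass \<beta> (- 1 / \<beta>) 0 q \<beta> =
    qpoch_inf (- \<beta>\<^sup>2) q * qpoch_inf q q * qpoch_inf q q * qpoch_inf (- (q / \<beta>\<^sup>2)) q" .
  moreover have "mass \<beta> (- 1 / \<beta>) 0 q \<beta> = qpoch_inf q q * mass 0 0 0 q \<beta>"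
    using mass_eq_mass_000[OF assms, of \<beta> "- 1 / \<beta>" 0] \<beta> by simp
  moreover have "qpoch_inf q q \<noteq> 0" by (rule qpoch_inf_nonzero) (use q in auto)
  ultimately show ?thesis by (simp add: mult_ac)
qed


section \<open>Polynomials in \<open>z - 1 / z\<close> and orthogonality\<close>

text \<open>
  As polynomials in \<open>X = z - 1/z\<close>, these are the products \<open>(z/a, -1/(az); q)\<^sub>k\<close>; see
  \<open>poly_basis_poly\<close>.
\<close>

definition basis_poly :: "complex \<Rightarrow> complex \<Rightarrow> nat \<Rightarrow> complex poly" where
  "basis_poly a q k = (\<Prod>i<k. [:1 - (q ^ i / a)\<^sup>2, - (q ^ i / a):])"

lemma poly_basis_poly:
  assumes "a \<noteq> 0" "z \<noteq> 0"
  shows "poly (basis_poly a q k) (z - 1 / z) = qpoch (z / a) q k * qpoch (- 1 / (a * z)) q k"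
  unfolding basis_poly_def qpoch_def poly_prod prod.distrib[symmetric]
  by (rule prod.cong) (use assms in \<open>simp_all add: field_simps power2_eq_square\<close>)

text \<open>
  Each linear factor of the basis polynomial is a multiple of the factor that \<open>theta_pair_div\<close>
  needs to divide the parameter by \<open>q\<close> once more.
\<close>

lemma poly_basis_poly_theta_pair:
  assumes "norm q < 1" "q \<noteq> 0" "a \<noteq> 0" "z \<noteq> 0"
  shows "poly (basis_poly a q k) (z - 1 / z) * theta_pair a q z =
    (\<Prod>i<k. - (q ^ i / a)\<^sup>2) * theta_pair (a / q ^ k) q z"
proof (induction k)
  case 0
  then show ?case by (simp add: basis_poly_def)
next
  case (Suc k)
  define a' where "a' = a / q ^ k"
  have a': "a' \<noteq> 0" "q ^ k / a = 1 / a'" "a / q ^ Suc k = a' / q"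
    using assms by (simp_all add: a'_def)
  have f: "1 - (1 / a')\<^sup>2 - 1 / a' * (z - 1 / z) = - (1 / a')\<^sup>2 * ((1 + z * a') * (1 - a' / z))"
    using a'(1) assms(4) by (simp add: field_simps power2_eq_square)
  have "poly (basis_poly a q (Suc k)) (z - 1 / z) * theta_pair a q z =
      (1 - (1 / a')\<^sup>2 - 1 / a' * (z - 1 / z)) * (poly (basis_poly a q k) (z - 1 / z) * theta_pair a q z)"
    unfolding basis_poly_def prod.lessThan_Suc poly_mult by (simp add: a'(2) algebra_simps)
  also have "\<dots> = (\<Prod>i<k. - (q ^ i / a)\<^sup>2) * (- (1 / a')\<^sup>2) * ((1 + z * a') * (1 - a' / z) * theta_pair a' q z)"
    unfolding Suc.IH f by (simp add: a'_def mult_ac)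
  also have "(1 + z * a') * (1 - a' / z) * theta_pair a' q z = theta_pair (a / q ^ Suc k) q z"
    unfolding a'(3) by (rule theta_pair_div[symmetric]) (use assms in auto)
  finally show ?case by (simp only: prod.lessThan_Suc a'(2))
qed

lemma prod_basis_factor:
  "(\<Prod>i<k. - (q ^ i / a)\<^sup>2) = (- 1 / a\<^sup>2) ^ k * (q ^ (k choose 2))\<^sup>2" for a q :: complex
proof (induction k)
  case (Suc k)
  show ?case unfolding prod.lessThan_Suc Suc.IH Suc_choose_two
    by (simp add: power_add power_mult_distrib power_divide)
qed (simp add: numeral_2_eq_2)

lemma degree_basis_poly:
  assumes "q \<noteq> 0" "a \<noteq> 0"
  shows "degree (basis_poly a q k) = k"
  unfolding basis_poly_def by (subst degree_prod_sum_eq) (use assms in auto)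

lemma lead_coeff_basis_poly:
  assumes "q \<noteq> 0" "a \<noteq> 0"
  shows "coeff (basis_poly a q k) k = (- 1 / a) ^ k * q ^ (k choose 2)"
proof -
  have "coeff (basis_poly a q k) k = lead_coeff (basis_poly a q k)"
    using degree_basis_poly[OF assms] by simp
  also have "\<dots> = (\<Prod>i<k. - (q ^ i / a))"
    unfolding basis_poly_def lead_coeff_prod using assms by simp
  also have "\<dots> = (- 1 / a) ^ k * q ^ (k choose 2)"
  proof (induction k)
    case (Suc k)
    show ?case unfolding prod.lessThan_Suc Suc.IH Suc_choose_two by (simp add: power_add)
  qed (simp add: numeral_2_eq_2)
  finally show ?thesis .
qed

text \<open>
  Besides the expansion, the top coefficient is recorded: it is all that the evaluation of the
  norms requires.
\<close>

lemma poly_expansion: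
  fixes B :: "nat \<Rightarrow> 'a::field poly"
  assumes B: "\<And>j. degree (B j) = j" "\<And>j. B j \<noteq> 0" and p: "degree p \<le> m"
  shows "\<exists>d. p = (\<Sum>j\<le>m. smult (d j) (B j)) \<and> d m * coeff (B m) m = coeff p m"
  using p
proof (induction m arbitrary: p)
  case 0
  have "coeff (B 0) 0 \<noteq> 0" using B[of 0] by (metis leading_coeff_neq_0)
  moreover obtain x y where "p = [:x:]" "B 0 = [:y:]"
    using 0 B(1)[of 0] by (metis degree_eq_zeroE le_zero_eq)
  ultimately have "p = smult (coeff p 0 / coeff (B 0) 0) (B 0)" by simp
  then show ?case
    using \<open>coeff (B 0) 0 \<noteq> 0\<close> by (intro exI[of _ "\<lambda>_. coeff p 0 / coeff (B 0) 0"]) auto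
next
  case (Suc m)
  have l: "coeff (B (Suc m)) (Suc m) \<noteq> 0" using B[of "Suc m"] by (metis leading_coeff_neq_0)
  define e where "e = coeff p (Suc m) / coeff (B (Suc m)) (Suc m)"
  define p' where "p' = p - smult e (B (Suc m))"
  have "degree p' \<le> m"
  proof (rule degree_le, intro allI impI)
    fix i assume "m < i"
    then consider "i = Suc m" | "i > Suc m" by linarith
    then show "coeff p' i = 0"
      by cases (use Suc.prems B(1)[of "Suc m"] l in \<open>auto simp: p'_def e_def coeff_eq_0\<close>)
  qed
  from Suc.IH[OF this] obtain d where d: "p' = (\<Sum>j\<le>m. smult (d j) (B j))" by blast
  have "p = p' + smult e (B (Suc m))" by (simp add: p'_def)
  then have "p = (\<Sum>j\<le>Suc m. smult ((d(Suc m := e)) j) (B j))" by (simp add: d)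
  moreover have "(d(Suc m := e)) (Suc m) * coeff (B (Suc m)) (Suc m) = coeff p (Suc m)"
    using l by (simp add: e_def)
  ultimately show ?case by blast
qed

lemma basis_expansion:
  assumes "q \<noteq> 0" "a \<noteq> 0" "degree p \<le> m"
  shows "\<exists>d. p = (\<Sum>j\<le>m. smult (d j) (basis_poly a q j)) \<and>
    d m * ((- 1 / a) ^ m * q ^ (m choose 2)) = coeff p m"
proof -
  have "basis_poly a q j \<noteq> 0" for j
    unfolding basis_poly_def using assms by (auto simp: prod_zero_iff)
  from poly_expansion[of "basis_poly a q", OF degree_basis_poly[OF assms(1,2)] this assms(3)]
  show ?thesis by (simp add: lead_coeff_basis_poly[OF assms(1,2)])
qed

lemma has_sum_sum_atMost:
  fixes f :: "nat \<Rightarrow> int \<Rightarrow> 'a::{topological_comm_monoid_add}"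
  assumes "\<And>j. (f j has_sum s j) A"
  shows "((\<lambda>k. \<Sum>j\<le>m. f j k) has_sum (\<Sum>j\<le>m. s j)) A"
  by (induction m) (auto intro!: has_sum_add assms)

text \<open>
  The summand of the linear functional \<open>pairing\<close> that sums a polynomial in \<open>z - 1/z\<close> against the
  weight.
\<close>

definition pairing_term :: "complex poly \<Rightarrow> complex \<Rightarrow> complex \<Rightarrow> complex \<Rightarrow> complex \<Rightarrow> complex \<Rightarrow> int \<Rightarrow> complex" where
  "pairing_term p a b c q \<beta> k = poly p (q powi k * \<beta> - 1 / (q powi k * \<beta>)) * weight a b c q \<beta> k"

lemma pairing_term_basis:
  assumes "norm q < 1" "q \<noteq> 0" "a \<noteq> 0" "\<beta> \<noteq> 0"
  shows "pairing_term (basis_poly a q j * p) a b c q \<beta> k =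
    (\<Prod>i<j. - (q ^ i / a)\<^sup>2) * pairing_term p (a / q ^ j) b c q \<beta> k"
proof -
  define z where "z = q powi k * \<beta>"
  have "z \<noteq> 0" using assms by (simp add: z_def)
  note * = poly_basis_poly_theta_pair[OF assms(1-3) this, of j]
  have "pairing_term (basis_poly a q j * p) a b c q \<beta> k =
    poly p (z - 1 / z) * (1 + z\<^sup>2) * ((poly (basis_poly a q j) (z - 1 / z) * theta_pair a q z) * theta_pair b q z * theta_pair c q z) *
     (q powi (2 * k\<^sup>2 - k) * \<beta> powi (4 * k))"
    by (simp add: pairing_term_def weight_def Let_def z_def)
  then show ?thesis
    unfolding * by (simp add: pairing_term_def weight_def Let_def z_def)
qed

lemma pairing_term_1: "pairing_term 1 a b c q \<beta> = weight a b c q \<beta>"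
  by (simp add: pairing_term_def fun_eq_iff)

lemma pairing_term_sum:
  "pairing_term (\<Sum>j\<le>m. smult (d j) (p j)) a b c q \<beta> k = (\<Sum>j\<le>m. d j * pairing_term (p j) a b c q \<beta> k)"
  by (simp add: pairing_term_def poly_sum sum_distrib_right mult.assoc)

text \<open>
  Expanding \<open>p\<close> in the basis of \<open>a\<close> turns the term into a combination of weights with parameters
  \<open>a/q\<^sup>j\<close>, so that the majorant of the weight also takes care of the polynomial factor.
\<close>

lemma pairing_term_bounded:
  assumes q: "0 < norm q" "norm q < 1" and a: "a \<noteq> 0" and B: "0 \<le> B"
  shows "\<exists>K. K summable_on UNIV \<and> (\<forall>\<beta> k. \<beta> \<noteq> 0 \<longrightarrow> norm \<beta> \<le> B \<longrightarrow> norm (1 / \<beta>) \<le> B \<longrightarrow>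
    norm (pairing_term p a b c q \<beta> k) \<le> K k)"
proof -
  have q0: "q \<noteq> 0" using q by auto
  obtain d where d: "p = (\<Sum>j\<le>degree p. smult (d j) (basis_poly a q j))"
    using basis_expansion[OF q0 a order.refl] by blast
  define e where "e j = d j * (\<Prod>i<j. - (q ^ i / a)\<^sup>2)" for j
  define A where "A j = B * norm (a / q ^ j) + B * norm b + B * norm c" for j
  have A: "0 \<le> A j" "B * norm (a / q ^ j) \<le> A j" "B * norm b \<le> A j" "B * norm c \<le> A j" for j
    using B by (auto simp: A_def)
  define K where "K k = (\<Sum>j\<le>degree p. norm (e j) * weight_bound (norm q) (A j) B (nat \<bar>k\<bar>))" for k :: int
  have "K summable_on UNIV"
    unfolding K_def
    by (rule has_sum_imp_summable[OF has_sum_sum_atMost], rule has_sum_infsum)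
       (intro summable_on_cmult_right weight_bound_summable_on q A B)
  moreover have "norm (pairing_term p a b c q \<beta> k) \<le> K k"
    if \<beta>: "\<beta> \<noteq> 0" "norm \<beta> \<le> B" "norm (1 / \<beta>) \<le> B" for \<beta> k
  proof -
    have b: "pairing_term (basis_poly a q j) a b c q \<beta> k =
        (\<Prod>i<j. - (q ^ i / a)\<^sup>2) * weight (a / q ^ j) b c q \<beta> k" for j
      using pairing_term_basis[OF q(2) q0 a \<beta>(1), of j 1 b c k] by (simp add: pairing_term_1)
    have "pairing_term p a b c q \<beta> k = (\<Sum>j\<le>degree p. e j * weight (a / q ^ j) b c q \<beta> k)"
      by (subst d) (simp add: pairing_term_sum b e_def mult.assoc)
    also have "norm \<dots> \<le> K k"
      unfolding K_def
      by (intro sum_norm_le) (auto simp: norm_mult intro!: mult_left_mono norm_weight_le q \<beta> A)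
    finally show ?thesis .
  qed
  ultimately show ?thesis by blast
qed

lemma pairing_summable:
  assumes q: "0 < norm q" "norm q < 1" and a: "a \<noteq> 0" and \<beta>: "\<beta> \<noteq> 0"
  shows "pairing_term p a b c q \<beta> summable_on UNIV"
proof -
  obtain B where B: "0 \<le> B" "norm \<beta> \<le> B" "norm (1 / \<beta>) \<le> B"
    by (rule obtain_bounds)
  obtain K where "K summable_on UNIV" "\<And>k. norm (pairing_term p a b c q \<beta> k) \<le> K k"
    using pairing_term_bounded[OF q a B(1), of p b c] \<beta> B by blast
  then show ?thesis by (rule summable_on_norm_le)
qed

definition pairing :: "complex poly \<Rightarrow> complex \<Rightarrow> complex \<Rightarrow> complex \<Rightarrow> complex \<Rightarrow> complex \<Rightarrow> complex" where
  "pairing p a b c q \<beta> = (\<Sum>\<^sub>\<infinity>k\<in>UNIV. pairing_term p a b c q \<beta> k)"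

lemma pairing_sum:
  fixes m :: nat
  assumes q: "0 < norm q" "norm q < 1" and a: "a \<noteq> 0" and \<beta>: "\<beta> \<noteq> 0"
  shows "pairing (\<Sum>j\<le>m. smult (d j) (p j)) a b c q \<beta> = (\<Sum>j\<le>m. d j * pairing (p j) a b c q \<beta>)"
  unfolding pairing_def pairing_term_sum
  by (rule infsumI, rule has_sum_sum_atMost)
     (intro has_sum_cmult_right has_sum_infsum pairing_summable assms)

lemma pairing_basis_basis:
  assumes q: "0 < norm q" "norm q < 1" and nz: "a \<noteq> 0" "b \<noteq> 0" and \<beta>: "\<beta> \<noteq> 0"
  shows "pairing (basis_poly a q k * basis_poly b q j) a b c q \<beta> =
    (\<Prod>i<k. - (q ^ i / a)\<^sup>2) * (\<Prod>i<j. - (q ^ i / b)\<^sup>2) * mass (a / q ^ k) (b / q ^ j) c q \<beta>"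
proof -
  have q0: "q \<noteq> 0" using q by auto
  have perm: "pairing_term p x y c q \<beta> l = pairing_term p y x c q \<beta> l" for p x y l
    by (simp add: pairing_term_def weight_def Let_def mult_ac)
  have "pairing_term (basis_poly b q j) (a / q ^ k) b c q \<beta> l =
      (\<Prod>i<j. - (q ^ i / b)\<^sup>2) * weight (a / q ^ k) (b / q ^ j) c q \<beta> l" for l
    using pairing_term_basis[OF q(2) q0 nz(2) \<beta>, of j 1 "a / q ^ k" c l]
    by (simp add: perm[of _ b] perm[of _ "b / q ^ j"] flip: pairing_term_1)
  then show ?thesis
    unfolding pairing_def mass_def pairing_term_basis[OF q(2) q0 nz(1) \<beta>]
    by (simp add: infsum_cmult_right' mult.assoc)
qed

definition hahn_coeff :: "nat \<Rightarrow> complex \<Rightarrow> complex \<Rightarrow> complex \<Rightarrow> complex \<Rightarrow> nat \<Rightarrow> complex" where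
  "hahn_coeff n a b c q k = (- (a * b * c)) ^ n / (q ^ (n choose 2))\<^sup>2 *
     (qbin q n k * (- 1 / (b * c)) ^ k *
      (qpoch (- (q ^ k / (a * b))) q (n - k) * qpoch (- (q ^ k / (a * c))) q (n - k)))"

text \<open>
  The polynomial \<open>p\<^sub>n\<close> as a polynomial in \<open>z - 1/z\<close>; see \<open>cd_qinv_Hahn_eq_poly\<close>.
\<close>

definition hahn_poly :: "nat \<Rightarrow> complex \<Rightarrow> complex \<Rightarrow> complex \<Rightarrow> complex \<Rightarrow> complex poly" where
  "hahn_poly n a b c q = (\<Sum>k\<le>n. smult (hahn_coeff n a b c q k) (basis_poly a q k))"

lemma powi_neg_choose: "q powi (- 2 * int (n choose 2)) = 1 / (q ^ (n choose 2))\<^sup>2" for q :: complex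
proof -
  have "- 2 * int (n choose 2) = - int (2 * (n choose 2))" by simp
  then show ?thesis
    by (simp only: power_int_minus power_int_of_nat power_mult power2_eq_square inverse_eq_divide power_mult_distrib)
qed

lemma cd_qinv_Hahn_eq_poly:
  assumes nz: "q \<noteq> 0" "a \<noteq> 0" "b \<noteq> 0" "c \<noteq> 0" "z \<noteq> 0"
  shows "cd_qinv_Hahn n z a b c q = poly (hahn_poly n a b c q) (z - 1 / z)"
proof -
  have "q powi (- 2 * int (n choose 2)) * (- (a * b * c)) ^ n *
      (qpochs [q powi (- int n), z / a, - 1 / (a * z)] q k / qpoch q q k *
       (- (q ^ n / (b * c))) ^ k *
       qpochs [- (q ^ k / (a * b)), - (q ^ k / (a * c))] q (n - k)) =
     hahn_coeff n a b c q k * poly (basis_poly a q k) (z - 1 / z)" for k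
  proof -
    have "(- (q ^ n / (b * c))) ^ k = (q ^ n) ^ k * (- 1 / (b * c)) ^ k"
      unfolding power_mult_distrib[symmetric] by simp
    then show ?thesis
      unfolding poly_basis_poly[OF nz(2,5)] hahn_coeff_def qbin_eq[OF nz(1), symmetric] powi_neg_choose
      by (simp add: qpochs_def)
  qed
  then show ?thesis
    unfolding cd_qinv_Hahn_explicit[OF nz] hahn_poly_def poly_sum sum_distrib_left by simp
qed

lemma qbin_n_n:
  assumes "norm q < 1"
  shows "qbin q n n = (- 1) ^ n * q ^ (n choose 2)"
proof (induction n)
  case (Suc n)
  show ?case unfolding qbin_Suc_Suc[OF assms] Suc.IH Suc_choose_two by (simp add: qbin_eq_0 power_add)
qed (simp add: numeral_2_eq_2)

lemma degree_hahn_poly: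
  assumes "q \<noteq> 0" "a \<noteq> 0"
  shows "degree (hahn_poly n a b c q) \<le> n"
  unfolding hahn_poly_def
  by (intro degree_sum_le) (auto intro: order.trans[OF degree_smult_le] simp: degree_basis_poly[OF assms])

lemma hahn_poly_monic:
  assumes q: "norm q < 1" and nz: "q \<noteq> 0" "a \<noteq> 0" "b \<noteq> 0" "c \<noteq> 0"
  shows "coeff (hahn_poly n a b c q) n = 1"
proof -
  have "coeff (hahn_poly n a b c q) n = (\<Sum>k\<le>n. hahn_coeff n a b c q k * coeff (basis_poly a q k) n)"
    by (simp add: hahn_poly_def coeff_sum)
  also have "\<dots> = (\<Sum>k\<in>{n}. hahn_coeff n a b c q k * coeff (basis_poly a q k) n)"
    by (rule sum.mono_neutral_right) (auto simp: coeff_eq_0 degree_basis_poly[OF nz(1,2)])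
  also have "\<dots> = (- (a * b * c)) ^ n * (- 1) ^ n * (- 1 / (b * c)) ^ n * (- 1 / a) ^ n *
      ((q ^ (n choose 2))\<^sup>2 / (q ^ (n choose 2))\<^sup>2)"
    by (simp add: hahn_coeff_def lead_coeff_basis_poly[OF nz(1,2)] qbin_n_n[OF q] power2_eq_square)
  also have "\<dots> = ((- (a * b * c)) * (- 1) * (- 1 / (b * c)) * (- 1 / a)) ^ n"
    using nz by (simp only: power_mult_distrib) simp
  also have "(- (a * b * c)) * (- 1) * (- 1 / (b * c)) * (- 1 / a) = 1"
    using nz by (simp add: field_simps)
  finally show ?thesis by simp
qed

lemma qpoch_negative_power:
  assumes q: "norm q < 1" "q \<noteq> 0"
  shows "qpoch (1 / q ^ n) q n = (- 1) ^ n * qpoch q q n / (q ^ (n choose 2) * q ^ n)"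
proof -
  have nz: "qpoch q q n \<noteq> 0"
    unfolding qpoch_def using one_minus_power_nonzero[OF q(1)] by (simp add: prod_zero_iff)
  have e: "q powi (- int n) = 1 / q ^ n" by (simp add: power_int_minus inverse_eq_divide)
  have "n * n = n + 2 * (n choose 2)"
  proof (induction n)
    case (Suc n)
    show ?case unfolding Suc_choose_two using Suc by simp
  qed (simp add: numeral_2_eq_2)
  then have p: "(q ^ n) ^ n = q ^ n * (q ^ (n choose 2) * q ^ (n choose 2))"
    by (simp add: mult_2 flip: power_mult power_add)
  have "qpoch (1 / q ^ n) q n / qpoch q q n * (q ^ n) ^ n = (- 1) ^ n * q ^ (n choose 2)"
    using qbin_eq[OF q(2), of n n] unfolding e qbin_n_n[OF q(1)] .
  then show ?thesis unfolding p using nz q(2) by (simp add: field_simps)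
qed

lemma qpoch_negative_power_eq_0:
  assumes "q \<noteq> 0" "j < n"
  shows "qpoch (1 / q ^ j) q n = 0"
  unfolding qpoch_def by (rule prod_zero) (use assms in \<open>auto intro!: bexI[of _ j]\<close>)

text \<open>
  Each \<open>pairing (basis_poly a q k * basis_poly b q j)\<close> is a mass with parameters \<open>a/q\<^sup>k\<close>
  and \<open>b/q\<^sup>j\<close>, hence an explicit product. By \<open>qpoch_inf_shift_down\<close> its dependence on \<open>k\<close> is through
  finite symbols, one of which completes \<open>(-q\<^sup>k/(ac); q)\<^bsub>n-k\<^esub>\<close> to \<open>(-1/(ac); q)\<^sub>n\<close>. What is left is
  the \<open>q\<close>-Chu-Vandermonde sum with \<open>s = q\<^sup>-\<^sup>j\<close> and \<open>v = -q\<^sup>j/(ab)\<close>.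
\<close>

lemma pairing_hahn_basis:
  assumes q: "0 < norm q" "norm q < 1" and nz: "a \<noteq> 0" "b \<noteq> 0" "c \<noteq> 0" and \<beta>: "\<beta> \<noteq> 0"
  shows "pairing (hahn_poly n a b c q * basis_poly b q j) a b c q \<beta> =
    (- (a * b * c)) ^ n / (q ^ (n choose 2))\<^sup>2 * (\<Prod>i<j. - (q ^ i / b)\<^sup>2) *
    qpoch_inf (- (q * (a * b / q ^ j))) q * qpoch_inf (- (q * (a * c))) q *
    qpoch_inf (- (q * (b * c / q ^ j))) q * mass 0 0 0 q \<beta> *
    qpoch (- (1 / (a * c))) q n * qpoch (1 / q ^ j) q n"
proof -
  have q0: "q \<noteq> 0" using q by auto
  define C where "C = (- (a * b * c)) ^ n / (q ^ (n choose 2))\<^sup>2"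
  define D where "D = (\<Prod>i<j. - (q ^ i / b)\<^sup>2)"
  define M where "M = mass 0 0 0 q \<beta>"
  define Iab Iac Ibc where I_def: "Iab = qpoch_inf (- (q * (a * b / q ^ j))) q"
    "Iac = qpoch_inf (- (q * (a * c))) q" "Ibc = qpoch_inf (- (q * (b * c / q ^ j))) q"
  define v where "v = - (q ^ j / (a * b))"
  have summand: "hahn_coeff n a b c q k * pairing (basis_poly a q k * basis_poly b q j) a b c q \<beta> =
      C * D * Iab * Iac * Ibc * M * qpoch (- (1 / (a * c))) q n *
      (qbin q n k * (1 / q ^ j) ^ k * qpoch v q k * qpoch (1 / q ^ j * v * q ^ k) q (n - k))"
    if k: "k \<le> n" for k
  proof -
    define Q where "Q = q ^ (k choose 2)"
    have Q: "Q \<noteq> 0" using q0 by (simp add: Q_def)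
    have "- (q * (a / q ^ k) * (b / q ^ j)) = - (q * (a * b / q ^ j / q ^ k))"
      "- (q * (a / q ^ k) * c) = - (q * (a * c / q ^ k))" "- (q * (b / q ^ j) * c) = - (q * (b * c / q ^ j))"
      "- (1 / (a * b / q ^ j)) = v"
      using nz q0 by (simp_all add: v_def field_simps)
    note e = this
    have m: "mass (a / q ^ k) (b / q ^ j) c q \<beta> =
        (Iab * ((a * b / q ^ j) ^ k / Q) * qpoch v q k) *
        (Iac * ((a * c) ^ k / Q) * qpoch (- (1 / (a * c))) q k) * Ibc * M"
      unfolding mass_eq_mass_000[OF q \<beta>, of "a / q ^ k"] e(1-3) I_def Q_def M_def
      using qpoch_inf_shift_down[OF q(2) q0, of "a * b / q ^ j" k]
        qpoch_inf_shift_down[OF q(2) q0, of "a * c" k] nz q0 e(4) by simp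
    have s1: "qpoch (- (1 / (a * c))) q n =
        qpoch (- (1 / (a * c))) q k * qpoch (- (q ^ k / (a * c))) q (n - k)"
      using qpoch_split[OF k, of "- (1 / (a * c))" q] by simp
    have s2: "1 / q ^ j * v * q ^ k = - (q ^ k / (a * b))"
      using q0 by (simp add: v_def)
    have "(- 1 / (b * c)) ^ k * (- 1 / a\<^sup>2) ^ k * (a * b / q ^ j) ^ k * (a * c) ^ k = (1 / q ^ j) ^ k"
      unfolding power_mult_distrib[symmetric]
      using nz q0 by (simp add: field_simps power2_eq_square)
    note pw = this
    have "hahn_coeff n a b c q k * pairing (basis_poly a q k * basis_poly b q j) a b c q \<beta> =
      C * (qbin q n k * (- 1 / (b * c)) ^ k * (qpoch (- (q ^ k / (a * b))) q (n - k) * qpoch (- (q ^ k / (a * c))) q (n - k))) *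
      ((- 1 / a\<^sup>2) ^ k * Q\<^sup>2 * D * ((Iab * ((a * b / q ^ j) ^ k / Q) * qpoch v q k) *
        (Iac * ((a * c) ^ k / Q) * qpoch (- (1 / (a * c))) q k) * Ibc * M))"
      unfolding pairing_basis_basis[OF q nz(1,2) \<beta>] m prod_basis_factor[where k = k] D_def[symmetric]
        hahn_coeff_def C_def[symmetric] Q_def[symmetric] ..
    also have "\<dots> = C * D * Iab * Iac * Ibc * M *
      (qpoch (- (1 / (a * c))) q k * qpoch (- (q ^ k / (a * c))) q (n - k)) *
      (qbin q n k * ((- 1 / (b * c)) ^ k * (- 1 / a\<^sup>2) ^ k * (a * b / q ^ j) ^ k * (a * c) ^ k) * qpoch v q k *
        qpoch (- (q ^ k / (a * b))) q (n - k))"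
      using Q by (simp add: power2_eq_square)
    finally show ?thesis unfolding pw s1 s2 .
  qed
  have "pairing (hahn_poly n a b c q * basis_poly b q j) a b c q \<beta> =
      (\<Sum>k\<le>n. hahn_coeff n a b c q k * pairing (basis_poly a q k * basis_poly b q j) a b c q \<beta>)"
    unfolding hahn_poly_def sum_distrib_right mult_smult_left
    by (rule pairing_sum[OF q nz(1) \<beta>])
  also have "\<dots> = C * D * Iab * Iac * Ibc * M * qpoch (- (1 / (a * c))) q n * qpoch (1 / q ^ j) q n"
    unfolding qChu_Vandermonde[OF q(2), of n "1 / q ^ j" v, symmetric] sum_distrib_left
    by (rule sum.cong) (auto simp: summand)
  finally show ?thesis by (simp only: C_def D_def I_def M_def)
qed

text \<open>
  The assumption \<open>m \<le> n\<close> makes every index \<open>j \<le> m\<close> of the expansion of \<open>p\<^sub>m\<close> except possibly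
  \<open>j = m\<close> smaller than \<open>n\<close>.
\<close>

lemma pairing_hahn_hahn:
  assumes q: "0 < norm q" "norm q < 1" and nz: "a \<noteq> 0" "b \<noteq> 0" "c \<noteq> 0" and \<beta>: "\<beta> \<noteq> 0"
    and mn: "m \<le> n"
  shows "pairing (hahn_poly n a b c q * hahn_poly m a b c q) a b c q \<beta> =
    (if m = n then mass 0 0 0 q \<beta> *
      (qpoch_inf (- (q * (a * b))) q * qpoch_inf (- (q * (a * c))) q * qpoch_inf (- (q * (b * c))) q) *
      (1 / (q ^ (n choose 2)) ^ 4) * (a\<^sup>2 * b\<^sup>2 * c\<^sup>2 / q) ^ n *
      (qpoch q q n * qpoch (- (1 / (a * b))) q n * qpoch (- (1 / (a * c))) q n * qpoch (- (1 / (b * c))) q n)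
     else 0)"
proof -
  have q0: "q \<noteq> 0" using q by auto
  obtain d where d: "hahn_poly m a b c q = (\<Sum>j\<le>m. smult (d j) (basis_poly b q j))"
    and dm: "d m * ((- 1 / b) ^ m * q ^ (m choose 2)) = 1"
    using basis_expansion[OF q0 nz(2) degree_hahn_poly[OF q0 nz(1)], of m b c]
    by (auto simp: hahn_poly_monic[OF q(2) q0 nz])
  have "pairing (hahn_poly n a b c q * hahn_poly m a b c q) a b c q \<beta> =
      (\<Sum>j\<le>m. d j * pairing (hahn_poly n a b c q * basis_poly b q j) a b c q \<beta>)"
    unfolding d sum_distrib_left mult_smult_right by (rule pairing_sum[OF q nz(1) \<beta>])
  also have "\<dots> = (\<Sum>j\<in>{m}. d j * pairing (hahn_poly n a b c q * basis_poly b q j) a b c q \<beta>)"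
    by (rule sum.mono_neutral_right)
       (use mn in \<open>auto simp: pairing_hahn_basis[OF q nz \<beta>] qpoch_negative_power_eq_0[OF q0]\<close>)
  finally have eq: "pairing (hahn_poly n a b c q * hahn_poly m a b c q) a b c q \<beta> =
      d m * pairing (hahn_poly n a b c q * basis_poly b q m) a b c q \<beta>" by simp
  show ?thesis
  proof (cases "m = n")
    case False
    then show ?thesis
      using eq mn by (simp add: pairing_hahn_basis[OF q nz \<beta>] qpoch_negative_power_eq_0[OF q0])
  next
    case True
    define Q where "Q = q ^ (n choose 2)"
    have Q: "Q \<noteq> 0" using q0 by (simp add: Q_def)
    have dn: "d n = (- b) ^ n / Q"
    proof -
      have "(- b) ^ n * (- 1 / b) ^ n = 1"
        unfolding power_mult_distrib[symmetric] using nz by simp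
      moreover have "(- b) ^ n * (d n * ((- 1 / b) ^ n * Q)) = (- b) ^ n"
        using dm by (simp add: True Q_def)
      ultimately have "d n * Q = (- b) ^ n" by (simp add: mult_ac)
      then show ?thesis using Q by (simp add: field_simps)
    qed
    have pw: "(- b) ^ n * (- (a * b * c)) ^ n * (- 1 / b\<^sup>2) ^ n * (a * b) ^ n * (b * c) ^ n * (- 1) ^ n / q ^ n =
        (a\<^sup>2 * b\<^sup>2 * c\<^sup>2 / q) ^ n"
    proof -
      have "(- b) ^ n * (- (a * b * c)) ^ n * (- 1 / b\<^sup>2) ^ n * (a * b) ^ n * (b * c) ^ n * (- 1) ^ n =
          (a\<^sup>2 * b\<^sup>2 * c\<^sup>2) ^ n"
        unfolding power_mult_distrib[symmetric] using nz by (simp add: power2_eq_square mult_ac)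
      then show ?thesis by (simp add: power_divide)
    qed
    (* Only the bookkeeping of the powers of Q = q^(n choose 2); the X1, ..., X6 are n-th powers, combined by pw. *)
  have arr: "(X1 / Q) * (X2 / Q\<^sup>2 * (X3 * Q\<^sup>2) * (Iab * (X4 / Q) * p1) * Iac * (Ibc * (X5 / Q) * p2) * M * p3 *
        (X6 * p4 / (Q * qn))) =
      M * (Iab * Iac * Ibc) * (1 / Q ^ 4) * (X1 * X2 * X3 * X4 * X5 * X6 / qn) * (p4 * p1 * p3 * p2)"
      for X1 X2 X3 X4 X5 X6 Iab Iac Ibc p1 p2 p3 p4 M qn
      using Q by (simp add: power2_eq_square eval_nat_numeral mult_ac)
    have ab: "a * b \<noteq> 0" and bc: "b * c \<noteq> 0" using nz by auto
    have p: "pairing (hahn_poly n a b c q * basis_poly b q n) a b c q \<beta> =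
        (- (a * b * c)) ^ n / Q\<^sup>2 * ((- 1 / b\<^sup>2) ^ n * Q\<^sup>2) *
        (qpoch_inf (- (q * (a * b))) q * ((a * b) ^ n / Q) * qpoch (- (1 / (a * b))) q n) *
        qpoch_inf (- (q * (a * c))) q *
        (qpoch_inf (- (q * (b * c))) q * ((b * c) ^ n / Q) * qpoch (- (1 / (b * c))) q n) *
        mass 0 0 0 q \<beta> * qpoch (- (1 / (a * c))) q n * ((- 1) ^ n * qpoch q q n / (Q * q ^ n))"
      unfolding pairing_hahn_basis[OF q nz \<beta>] prod_basis_factor qpoch_inf_shift_down[OF q(2) q0 ab]
        qpoch_inf_shift_down[OF q(2) q0 bc] qpoch_negative_power[OF q(2) q0] Q_def ..
    show ?thesis
      unfolding eq unfolding True dn p arr pw by (simp add: Q_def)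
  qed
qed


section \<open>The complex Gaussian integral\<close>

lemma integrable_real_gaussian:
  fixes p s :: real
  assumes "p > 0"
  shows "integrable lborel (\<lambda>x. exp (- p * x\<^sup>2 + s * x))"
proof -
  define \<sigma> \<mu> where "\<sigma> = 1 / sqrt (2 * p)" and "\<mu> = s / (2 * p)"
  have s2: "\<sigma>\<^sup>2 = 1 / (2 * p)" and s0: "\<sigma> > 0" using assms by (simp_all add: \<sigma>_def power_divide)
  have "exp (- p * x\<^sup>2 + s * x) = (exp (s\<^sup>2 / (4 * p)) * sqrt (2 * pi * \<sigma>\<^sup>2)) * normal_density \<mu> \<sigma> x" for x
  proof -
    have "- p * x\<^sup>2 + s * x = s\<^sup>2 / (4 * p) + (- (x - \<mu>)\<^sup>2 / (2 * \<sigma>\<^sup>2))"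
      unfolding s2 \<mu>_def using assms by (simp add: field_simps power2_eq_square)
    then have "exp (- p * x\<^sup>2 + s * x) = exp (s\<^sup>2 / (4 * p)) * exp (- (x - \<mu>)\<^sup>2 / (2 * \<sigma>\<^sup>2))"
      by (simp only: exp_add)
    then show ?thesis using s0 by (simp add: normal_density_def)
  qed
  then show ?thesis
    by (simp only:) (intro integrable_mult_right integrable_normal_density s0)
qed

lemma norm_gaussian:
  "norm (exp (- A * of_real x ^ 2 + B * of_real x)) = exp (- Re A * x\<^sup>2 + Re B * x)" for A B :: complex
  by (simp add: norm_exp_eq_Re power2_eq_square)

lemma integrable_gaussian:
  assumes "Re A > 0"
  shows "integrable lborel (\<lambda>x::real. exp (- A * of_real x ^ 2 + B * of_real x))"
proof -
  have "(\<lambda>x::real. exp (- A * of_real x ^ 2 + B * of_real x)) \<in> borel_measurable lborel"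
    by measurable
  then show ?thesis
    by (subst integrable_norm_iff[symmetric])
       (simp_all only: norm_gaussian integrable_real_gaussian[OF assms])
qed

text \<open>
  For real \<open>p\<close>, the real part of \<open>B\<close> is absorbed by an affine substitution, and its imaginary part
  then appears as the argument of the characteristic function of the standard normal
  distribution.
\<close>

lemma gaussian_integral_real:
  fixes p :: real and B :: complex
  assumes p: "p > 0"
  shows "(LBINT x. exp (- complex_of_real p * of_real x ^ 2 + B * of_real x)) =
    of_real (sqrt pi) / csqrt (of_real p) * exp (B\<^sup>2 / (4 * of_real p))"
proof -
  define s t where "s = Re B" and "t = Im B"
  define \<sigma> \<mu> where "\<sigma> = 1 / sqrt (2 * p)" and "\<mu> = s / (2 * p)"
  have s2: "\<sigma>\<^sup>2 = 1 / (2 * p)" and s0: "\<sigma> > 0" using p by (simp_all add: \<sigma>_def power_divide)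
  define c where "c = of_real (s\<^sup>2 / (4 * p)) + \<i> * of_real (t * \<mu>)"
  have B: "B = of_real s + \<i> * of_real t" by (simp add: s_def t_def complex_eq_iff)
  have "- complex_of_real p * of_real (\<mu> + \<sigma> * y) ^ 2 + B * of_real (\<mu> + \<sigma> * y) =
      c + (of_real (- y\<^sup>2 / 2) + \<i> * of_real (t * \<sigma> * y))" for y
  proof -
    have "- p * (\<mu> + \<sigma> * y)\<^sup>2 + s * (\<mu> + \<sigma> * y) = s\<^sup>2 / (4 * p) - y\<^sup>2 / 2"
    proof -
      have "- p * (\<mu> + \<sigma> * y)\<^sup>2 + s * (\<mu> + \<sigma> * y) =
          - p * \<mu>\<^sup>2 + s * \<mu> + (s - 2 * p * \<mu>) * \<sigma> * y - p * \<sigma>\<^sup>2 * y\<^sup>2"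
        by (simp add: power2_eq_square algebra_simps)
      also have "s - 2 * p * \<mu> = 0" using p by (simp add: \<mu>_def)
      also have "- p * \<mu>\<^sup>2 + s * \<mu> = s\<^sup>2 / (4 * p)"
        using p by (simp add: \<mu>_def power2_eq_square field_simps)
      finally show ?thesis using p by (simp add: s2)
    qed
    then show ?thesis
      by (simp add: B c_def complex_eq_iff power2_eq_square algebra_simps)
  qed
  note expo = this
  have sd: "exp (complex_of_real (- y\<^sup>2 / 2)) = of_real (sqrt (2 * pi)) * of_real (std_normal_density y)" for y
  proof -
    have "exp (- y\<^sup>2 / 2) = sqrt (2 * pi) * std_normal_density y"
      by (simp add: normal_density_def)
    then show ?thesis unfolding exp_of_real by (simp only: of_real_mult)
  qed
  have ex: "exp (- complex_of_real p * of_real (\<mu> + \<sigma> * y) ^ 2 + B * of_real (\<mu> + \<sigma> * y)) =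
      of_real (sqrt (2 * pi)) * exp c * (std_normal_density y *\<^sub>R exp (\<i> * of_real (t * \<sigma> * y)))" for y
    unfolding expo exp_add sd scaleR_conv_of_real by (simp only: mult_ac)
  have "(LBINT x. exp (- complex_of_real p * of_real x ^ 2 + B * of_real x)) =
      \<sigma> *\<^sub>R (LBINT y. exp (- complex_of_real p * of_real (\<mu> + \<sigma> * y) ^ 2 + B * of_real (\<mu> + \<sigma> * y)))"
    using s0 by (subst lborel_integral_real_affine[of \<sigma> _ \<mu>]) auto
  also have "\<dots> = \<sigma> *\<^sub>R (of_real (sqrt (2 * pi)) * exp c *
      (LBINT y. std_normal_density y *\<^sub>R exp (\<i> * of_real (t * \<sigma> * y))))"
    by (simp only: ex integral_mult_right_zero)
  also have "(LBINT y. std_normal_density y *\<^sub>R exp (\<i> * of_real (t * \<sigma> * y))) = char std_normal_distribution (t * \<sigma>)"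
    unfolding char_def by (subst integral_density) auto
  also have "\<dots> = of_real (exp (- (t * \<sigma>)\<^sup>2 / 2))"
    by (simp add: char_std_normal_distribution)
  also have "\<sigma> *\<^sub>R (of_real (sqrt (2 * pi)) * exp c * of_real (exp (- (t * \<sigma>)\<^sup>2 / 2))) =
      of_real (\<sigma> * sqrt (2 * pi)) * exp (c + of_real (- (t * \<sigma>)\<^sup>2 / 2))"
    by (simp only: scaleR_conv_of_real exp_add exp_of_real of_real_mult mult_ac)
  also have "\<sigma> * sqrt (2 * pi) = sqrt pi / sqrt p"
    using p by (simp add: \<sigma>_def real_sqrt_mult)
  also have "c + of_real (- (t * \<sigma>)\<^sup>2 / 2) = B\<^sup>2 / (4 * of_real p)"
    unfolding power_mult_distrib s2 B c_def \<mu>_def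
    using p by (simp add: field_simps power2_eq_square)
  finally show ?thesis using p by (simp flip: of_real_sqrt)
qed

text \<open>
  On the disc of radius \<open>p\<close> about \<open>p\<close>, expand \<open>exp ((p - A) x\<^sup>2)\<close> as a power series in \<open>A - p\<close>.
  Since \<open>|A - p| < p\<close>, all partial sums are dominated by the integrable function
  \<open>exp (-(p - |A - p|) x\<^sup>2 + Re B x)\<close>, so the integral is the sum of a power series.
\<close>

lemma gaussian_integral_holomorphic:
  fixes p :: real and B :: complex
  assumes p: "p > 0"
  shows "(\<lambda>A. LBINT x. exp (- A * of_real x ^ 2 + B * of_real x)) holomorphic_on ball (of_real p) p"
proof (rule power_series_holomorphic)
  let ?E = "\<lambda>x::real. exp (- complex_of_real p * of_real x ^ 2 + B * of_real x)"
  let ?a = "\<lambda>n. LBINT x. (- (of_real x ^ 2)) ^ n / fact n * ?E x"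
  fix w assume w: "w \<in> ball (complex_of_real p) p"
  define d where "d = w - of_real p"
  have d: "norm d < p" using w by (simp add: d_def dist_norm norm_minus_commute)
  let ?h = "\<lambda>n x. (d * (- (complex_of_real x ^ 2))) ^ n / fact n * ?E x"
  let ?g = "\<lambda>x. exp (- (p - norm d) * x\<^sup>2 + Re B * x)"
  have g: "integrable lborel ?g" by (rule integrable_real_gaussian) (use d in simp)
  have E: "norm (?E x) = exp (- p * x\<^sup>2 + Re B * x)" for x
    by (simp add: norm_gaussian)
  have geq: "?g x = exp (norm d * x\<^sup>2) * norm (?E x)" for x
    unfolding E by (simp add: algebra_simps flip: exp_add)
  have expsum: "(\<Sum>k<n. y ^ k / fact k) \<le> exp y" if "y \<ge> 0" for y :: real and n
    unfolding exp_def using summable_exp[of y] that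
    by (intro order.trans[OF sum_le_suminf[of _ "{..<n}"]]) (auto simp: divide_inverse mult.commute)
  have norm_h: "norm (?h n x) = (norm d * x\<^sup>2) ^ n / fact n * norm (?E x)" for n x
    by (simp add: norm_mult norm_divide norm_power power_mult_distrib)
  have bound: "norm (\<Sum>k<n. ?h k x) \<le> ?g x" for n x
  proof -
    have "norm (\<Sum>k<n. ?h k x) \<le> (\<Sum>k<n. norm (?h k x))" by (rule norm_sum)
    also have "\<dots> = (\<Sum>k<n. (norm d * x\<^sup>2) ^ k / fact k) * norm (?E x)"
      by (simp only: norm_h sum_distrib_right)
    also have "\<dots> \<le> ?g x"
      unfolding geq by (intro mult_right_mono expsum) auto
    finally show ?thesis .
  qed
  have bound1: "norm (?h n x) \<le> ?g x" for n x
  proof -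
    have "(norm d * x\<^sup>2) ^ n / fact n \<le> (\<Sum>k<Suc n. (norm d * x\<^sup>2) ^ k / fact k)"
      by (rule member_le_sum) auto
    also have "\<dots> \<le> exp (norm d * x\<^sup>2)" by (rule expsum) simp
    finally show ?thesis unfolding norm_h geq by (rule mult_right_mono) simp
  qed
  have meas: "?h n \<in> borel_measurable lborel" for n by measurable
  have int: "integrable lborel (?h n)" for n
    by (rule Bochner_Integration.integrable_bound[OF g meas]) (use bound1 in \<open>auto intro!: always_eventually\<close>)
  have "(\<lambda>n. LBINT x. (\<Sum>k<n. ?h k x)) \<longlonglongrightarrow> (LBINT x. exp (- w * of_real x ^ 2 + B * of_real x))"
  proof (rule integral_dominated_convergence[OF _ _ g])
    show "AE x in lborel. (\<lambda>n. \<Sum>k<n. ?h k x) \<longlonglongrightarrow> exp (- w * of_real x ^ 2 + B * of_real x)"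
    proof (rule always_eventually, rule allI)
      fix x :: real
      have "(\<lambda>k. (d * (- (complex_of_real x ^ 2))) ^ k / fact k * ?E x) sums (exp (d * (- (complex_of_real x ^ 2))) * ?E x)"
        using exp_converges[of "d * (- (complex_of_real x ^ 2))"]
        by (intro sums_mult2) (simp add: divide_inverse scaleR_conv_of_real mult.commute)
      also have "exp (d * (- (complex_of_real x ^ 2))) * ?E x = exp (- w * of_real x ^ 2 + B * of_real x)"
        unfolding exp_add[symmetric] by (simp add: d_def algebra_simps)
      finally show "(\<lambda>n. \<Sum>k<n. ?h k x) \<longlonglongrightarrow> exp (- w * of_real x ^ 2 + B * of_real x)"
        by (simp only: sums_def)
    qed
  next
    show "(\<lambda>x. \<Sum>k<n. ?h k x) \<in> borel_measurable lborel" for n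
      by (intro borel_measurable_sum meas)
  qed (use bound in \<open>auto intro!: always_eventually\<close>)
  moreover have "(LBINT x. (\<Sum>k<n. ?h k x)) = (\<Sum>k<n. ?a k * d ^ k)" for n
  proof -
    have "(LBINT x. (\<Sum>k<n. ?h k x)) = (\<Sum>k<n. LBINT x. ?h k x)"
      by (rule Bochner_Integration.integral_sum[OF int])
    also have "\<dots> = (\<Sum>k<n. LBINT x. d ^ k * ((- (of_real x ^ 2)) ^ k / fact k * ?E x))"
      by (simp only: power_mult_distrib times_divide_eq_right mult.assoc times_divide_eq_left)
    also have "\<dots> = (\<Sum>k<n. ?a k * d ^ k)"
      by (simp only: integral_mult_right_zero mult.commute)
    finally show ?thesis .
  qed
  ultimately show "(\<lambda>n. ?a n * (w - of_real p) ^ n) sums (LBINT x. exp (- w * of_real x ^ 2 + B * of_real x))"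
    by (simp only: sums_def d_def)
qed

text \<open>
  The discs of radius \<open>p\<close> about \<open>p > 0\<close> exhaust the half-plane \<open>Re A > 0\<close>, and both sides agree
  on the real points of each.
\<close>

lemma gaussian_integral:
  fixes A B :: complex
  assumes A: "Re A > 0"
  shows "(LBINT x. exp (- A * of_real x ^ 2 + B * of_real x)) =
    of_real (sqrt pi) / csqrt A * exp (B\<^sup>2 / (4 * A))"
proof -
  (* |A - p| < p holds exactly for p > |A|^2 / (2 Re A). *)
  define p where "p = (norm A)\<^sup>2 / (2 * Re A) + 1"
  have p: "p > 0" using A by (auto simp: p_def intro!: add_nonneg_pos)
  have "(norm A)\<^sup>2 < 2 * p * Re A" using A by (simp add: p_def field_simps)
  moreover have "(norm (of_real p - A))\<^sup>2 = p\<^sup>2 - 2 * p * Re A + (norm A)\<^sup>2"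
    unfolding cmod_power2 by (simp add: power2_eq_square algebra_simps)
  ultimately have "(norm (of_real p - A))\<^sup>2 < p\<^sup>2" by simp
  then have Ap: "A \<in> ball (of_real p) p"
    using p by (simp add: dist_norm power_less_imp_less_base)
  let ?S = "ball (complex_of_real p) p"
  let ?f = "\<lambda>A. (LBINT x. exp (- A * of_real x ^ 2 + B * of_real x)) -
    of_real (sqrt pi) / csqrt A * exp (B\<^sup>2 / (4 * A))"
  have Re_pos: "Re w > 0" if "w \<in> ?S" for w
  proof -
    have "\<bar>Re (of_real p - w)\<bar> < p" using that abs_Re_le_cmod[of "of_real p - w"] by (simp add: dist_norm)
    then show ?thesis by simp
  qed
  have slit: "w \<notin> \<real>\<^sub>\<le>\<^sub>0" "w \<noteq> 0" if "w \<in> ?S" for w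
    using Re_pos[OF that] by (auto simp: complex_nonpos_Reals_iff)
  have holo: "(\<lambda>A. of_real (sqrt pi) / csqrt A * exp (B\<^sup>2 / (4 * A))) holomorphic_on ?S"
    by (intro holomorphic_intros) (simp_all only: slit csqrt_eq_0 mult_eq_0_iff, simp_all)
  have "?f A = 0"
  proof (rule analytic_continuation[where f = ?f and w = A and S = ?S and U = "complex_of_real ` {0<..<2 * p}" and \<xi> = "of_real p"])
    show "?f holomorphic_on ?S"
      by (rule holomorphic_on_diff[OF gaussian_integral_holomorphic[OF p] holo])
    show "complex_of_real ` {0<..<2 * p} \<subseteq> ?S"
      by (auto simp: dist_norm abs_less_iff simp flip: of_real_diff)
    show "of_real p islimpt complex_of_real ` {0<..<2 * p}"
    proof (rule connected_imp_perfect)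
      show "connected (complex_of_real ` {0<..<2 * p})"
        by (intro connected_continuous_image continuous_intros) auto
      show "of_real p \<in> complex_of_real ` {0<..<2 * p}" using p by auto
      have half: "of_real (p / 2) \<in> complex_of_real ` {0<..<2 * p}" using p by (intro imageI) simp
      show "complex_of_real ` {0<..<2 * p} \<noteq> {x}" for x
      proof
        assume "complex_of_real ` {0<..<2 * p} = {x}"
        then have "complex_of_real p = of_real (p / 2)"
          using half \<open>of_real p \<in> complex_of_real ` {0<..<2 * p}\<close> by auto
        then show False using p unfolding of_real_eq_iff by simp
      qed
    qed
    show "?f w = 0" if "w \<in> complex_of_real ` {0<..<2 * p}" for w
      using that gaussian_integral_real[of _ B] by auto
  qed (use p Ap in auto)
  then show ?thesis by simp
qed

section \<open>Folding a line integral into a unit interval\<close>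

text \<open>
  The integral over the line is the sum of the integrals over \<open>[k, k + 1)\<close>, each of which is
  translated to the unit interval. The uniform majorant \<open>K\<close> justifies both exchanges of sum and
  integral.
\<close>

lemma line_integral_fold:
  fixes f :: "real \<Rightarrow> complex" and K :: "int \<Rightarrow> real"
  assumes f [measurable]: "f \<in> borel_measurable borel"
    and K: "K summable_on UNIV"
    and bound: "\<And>x k. 0 \<le> x \<Longrightarrow> x \<le> 1 \<Longrightarrow> norm (f (x + of_int k)) \<le> K k"
  shows "integrable lborel f"
    and "set_integrable lborel {0..1} (\<lambda>x. \<Sum>\<^sub>\<infinity>k\<in>UNIV. f (x + of_int k))"
    and "(LBINT x. f x) = (LBINT x:{0..1}. \<Sum>\<^sub>\<infinity>k\<in>UNIV. f (x + of_int k))"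
proof -
  define \<kappa> where "\<kappa> n = real_of_int (int_decode n)" for n
  define K' where "K' n = K (int_decode n)" for n
  have K': "summable K'" unfolding K'_def by (rule summable_on_int_imp_summable[OF K])
  have K'_bound: "norm (f (x + \<kappa> n)) \<le> K' n" if "0 \<le> x" "x \<le> 1" for x n
    using bound[OF that] by (simp add: \<kappa>_def K'_def)
  have K'0: "0 \<le> K' n" for n using order_trans[OF norm_ge_zero K'_bound[of 0 n]] by simp

  define g where "g n x = indicator {0..1} x *\<^sub>R f (x + \<kappa> n)" for n x
  define g' where "g' n x = indicator {0..<1} x *\<^sub>R f (x + \<kappa> n)" for n x
  (* Half-open intervals make the pieces h n disjoint, so that f is literally their sum. Their translates
     g' n differ from g n only at the point 1. *)
  define h where "h n x = indicator {\<kappa> n..<\<kappa> n + 1} x *\<^sub>R f x" for n x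
  have [measurable]: "g n \<in> borel_measurable borel" "g' n \<in> borel_measurable borel"
    "h n \<in> borel_measurable borel" for n
    unfolding g_def g'_def h_def by measurable
  have ind: "integrable lborel (\<lambda>x::real. indicator {0..1} x *\<^sub>R K' n)" for n by simp
  have g_le: "norm (g n x) \<le> indicator {0..1} x *\<^sub>R K' n" for n x
    using K'_bound[of x n] by (auto simp: g_def indicator_def)
  have g'_le: "norm (g' n x) \<le> indicator {0..1} x *\<^sub>R K' n" for n x
    using K'_bound[of x n] K'0 by (auto simp: g'_def indicator_def)
  have g_int: "integrable lborel (g n)" for n
    by (rule Bochner_Integration.integrable_bound[OF ind[of n]])
       (use g_le K'0 in \<open>auto intro!: always_eventually simp: abs_of_nonneg\<close>)
  have g'_int: "integrable lborel (g' n)" for n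
    by (rule Bochner_Integration.integrable_bound[OF ind[of n]])
       (use g'_le K'0 in \<open>auto intro!: always_eventually simp: abs_of_nonneg\<close>)
  have h_shift: "h n (\<kappa> n + 1 * x) = g' n x" for n x
    by (auto simp: h_def g'_def indicator_def add.commute)
  have h_int: "integrable lborel (h n)" for n
    using g'_int[of n] lborel_integrable_real_affine_iff[of 1 "h n" "\<kappa> n"] by (simp add: h_shift[simplified])
  have h_eq: "integral\<^sup>L lborel (h n) = integral\<^sup>L lborel (g n)" for n
  proof -
    have "integral\<^sup>L lborel (h n) = integral\<^sup>L lborel (g' n)"
      using lborel_integral_real_affine[of 1 "h n" "\<kappa> n"] by (simp add: h_shift[simplified])
    also have "\<dots> = integral\<^sup>L lborel (g n)"
    proof (rule integral_cong_AE)
      show "AE x in lborel. g' n x = g n x"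
        using AE_lborel_singleton[of "1::real"]
        by eventually_elim (auto simp: g_def g'_def indicator_def)
    qed auto
    finally show ?thesis .
  qed
  have ind_int: "(LBINT x. indicator {0..1::real} x *\<^sub>R K' n) = K' n" for n by simp
  have norm_g: "(LBINT x. norm (g n x)) \<le> K' n" for n
    using integral_mono[OF integrable_norm[OF g_int[of n]] ind[of n] g_le] ind_int[of n] by simp
  have norm_h: "(LBINT x. norm (h n x)) \<le> K' n" for n
  proof -
    have "(LBINT x. norm (h n x)) = (LBINT x. norm (g' n x))"
      using lborel_integral_real_affine[of 1 "\<lambda>x. norm (h n x)" "\<kappa> n"] by (simp add: h_shift[simplified])
    also have "\<dots> \<le> K' n"
      using integral_mono[OF integrable_norm[OF g'_int[of n]] ind[of n] g'_le] ind_int[of n] by simp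
    finally show ?thesis .
  qed
  have sum_g: "summable (\<lambda>n. LBINT x. norm (g n x))"
    by (rule summable_comparison_test'[OF K']) (use norm_g in simp)
  have sum_h: "summable (\<lambda>n. LBINT x. norm (h n x))"
    by (rule summable_comparison_test'[OF K']) (use norm_h in simp)
  have ae_g: "AE x in lborel. summable (\<lambda>n. norm (g n x))"
  proof (rule always_eventually, rule allI)
    fix x :: real
    have "norm (g n x) \<le> K' n" for n
      using g_le[of n x] K'0[of n] by (cases "0 \<le> x \<and> x \<le> 1") (auto simp: indicator_def)
    then show "summable (\<lambda>n. norm (g n x))"
      by (intro summable_comparison_test'[OF K']) simp
  qed
  have h_zero: "h n x = 0" if "n \<noteq> int_encode \<lfloor>x\<rfloor>" for n x
  proof -
    have "int_decode n \<noteq> \<lfloor>x\<rfloor>" using that by (metis int_decode_inverse)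
    then have "\<not> (\<kappa> n \<le> x \<and> x < \<kappa> n + 1)" unfolding \<kappa>_def by (metis floor_unique)
    then show ?thesis by (auto simp: h_def indicator_def)
  qed
  have h_sum: "(\<Sum>n. h n x) = f x" for x
  proof -
    have "(\<Sum>n. h n x) = (\<Sum>n\<in>{int_encode \<lfloor>x\<rfloor>}. h n x)"
      by (rule suminf_finite) (use h_zero in auto)
    also have "\<dots> = f x" by (simp add: h_def \<kappa>_def indicator_def)
    finally show ?thesis .
  qed
  have ae_h: "AE x in lborel. summable (\<lambda>n. norm (h n x))"
    by (rule always_eventually, rule allI, rule summable_finite[of "{int_encode \<lfloor>_\<rfloor>}"])
       (use h_zero in auto)
  have g_sum: "(\<Sum>n. g n x) = indicator {0..1} x *\<^sub>R (\<Sum>\<^sub>\<infinity>k\<in>UNIV. f (x + of_int k))" for x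
  proof (cases "0 \<le> x \<and> x \<le> 1")
    case True
    then have "(\<lambda>k::int. f (x + of_int k)) summable_on UNIV"
      by (intro summable_on_norm_le[OF K]) (use bound in auto)
    from infsum_int_eq_suminf[OF this] show ?thesis
      using True by (simp add: g_def \<kappa>_def sums_iff)
  qed (auto simp: g_def indicator_def)
  show "integrable lborel f"
    using integrable_suminf[OF h_int ae_h sum_h] by (simp add: h_sum)
  show "set_integrable lborel {0..1} (\<lambda>x. \<Sum>\<^sub>\<infinity>k\<in>UNIV. f (x + of_int k))"
    using integrable_suminf[OF g_int ae_g sum_g] by (simp add: g_sum set_integrable_def)
  have "(LBINT x. f x) = (\<Sum>n. integral\<^sup>L lborel (h n))"
    using integral_suminf[OF h_int ae_h sum_h] by (simp add: h_sum)
  also have "\<dots> = (LBINT x. \<Sum>n. g n x)"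
    unfolding h_eq using integral_suminf[OF g_int ae_g sum_g] by simp
  finally show "(LBINT x. f x) = (LBINT x:{0..1}. \<Sum>\<^sub>\<infinity>k\<in>UNIV. f (x + of_int k))"
    by (simp add: g_sum set_lebesgue_integral_def)
qed


section \<open>Evaluation of the bilateral sum\<close>

lemma Psi_term_eq_pairing_term:
  assumes nz: "q \<noteq> 0" "a \<noteq> 0" "b \<noteq> 0" "c \<noteq> 0" and \<beta>: "\<beta> \<noteq> 0"
  shows "Psi_term m n a b c q \<beta> k =
    pairing_term (hahn_poly n a b c q * hahn_poly m a b c q) a b c q \<beta> k"
proof -
  define z where "z = q powi k * \<beta>"
  have z0: "z \<noteq> 0" using nz \<beta> by (simp add: z_def)
  have "q powi (2 * k) * \<beta>\<^sup>2 = z\<^sup>2"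
    by (simp add: z_def power_mult_distrib power_int_mult mult.commute[of 2 k])
  moreover have "qpochs_inf [- (q powi (k + 1) * \<beta> * t), q powi (1 - k) * t / \<beta>] q = theta_pair t q z" for t
  proof -
    have "- (q powi (k + 1) * \<beta> * t) = - (q * z * t)"
      using nz by (simp add: z_def power_int_add)
    moreover have "q powi (1 - k) * t / \<beta> = q * t / z"
      using nz by (simp add: z_def power_int_diff)
    moreover have "qpochs_inf [x, y] q = qpoch_inf x q * qpoch_inf y q" for x y
      by (simp add: qpochs_inf_def)
    ultimately show ?thesis unfolding theta_pair_def by (simp only:)
  qed
  ultimately show ?thesis
    using cd_qinv_Hahn_eq_poly[OF nz z0]
    by (simp add: Psi_term_def pairing_term_def weight_def Let_def z_def[symmetric])
qed

definition Psi_const :: "nat \<Rightarrow> nat \<Rightarrow> complex \<Rightarrow> complex \<Rightarrow> complex \<Rightarrow> complex \<Rightarrow> complex" where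
  "Psi_const m n a b c q = (if m = n then
      (qpoch_inf (- (q * (a * b))) q * qpoch_inf (- (q * (a * c))) q * qpoch_inf (- (q * (b * c))) q) *
      (1 / (q ^ (n choose 2)) ^ 4) * (a\<^sup>2 * b\<^sup>2 * c\<^sup>2 / q) ^ n *
      (qpoch q q n * qpoch (- (1 / (a * b))) q n * qpoch (- (1 / (a * c))) q n * qpoch (- (1 / (b * c))) q n)
     else 0)"

text \<open>
  The constant does not depend on \<open>\<beta>\<close>. Integrating over \<open>\<beta> = q\<^sup>x\<alpha>\<close> therefore only involves the
  mass with zero parameters.
\<close>

lemma Psi_eq_mass:
  assumes q: "0 < norm q" "norm q < 1" and nz: "a \<noteq> 0" "b \<noteq> 0" "c \<noteq> 0" and \<beta>: "\<beta> \<noteq> 0"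
  shows "Psi m n a b c q \<beta> = Psi_const m n a b c q * mass 0 0 0 q \<beta>"
proof -
  have q0: "q \<noteq> 0" using q by auto
  have "Psi m n a b c q \<beta> = pairing (hahn_poly n a b c q * hahn_poly m a b c q) a b c q \<beta>"
    unfolding Psi_def pairing_def Psi_term_eq_pairing_term[OF q0 nz \<beta>] ..
  also have "\<dots> = Psi_const m n a b c q * mass 0 0 0 q \<beta>"
  proof (cases "m \<le> n")
    case True
    then show ?thesis
      unfolding pairing_hahn_hahn[OF q nz \<beta> True] Psi_const_def by (simp add: mult_ac)
  next
    case False
    then have "n \<le> m" "m \<noteq> n" by auto
    then show ?thesis
      using pairing_hahn_hahn[OF q nz \<beta>, of n m] by (simp add: Psi_const_def mult.commute)
  qed
  finally show ?thesis .
qed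

section \<open>The integral over the real line\<close>

text \<open>
  The part of the integrand that is not a function of \<open>q\<^sup>x\<alpha>\<close>.
\<close>

definition gauss_factor :: "complex \<Rightarrow> complex \<Rightarrow> real \<Rightarrow> complex" where
  "gauss_factor q \<alpha> x = q powr of_real (2 * x\<^sup>2 - x) * \<alpha> powr of_real (4 * x)"

lemma powr_of_real_add_int:
  fixes q :: complex
  assumes "q \<noteq> 0"
  shows "q powr of_real (x + of_int k) = q powi k * q powr of_real x"
proof -
  have "q powr of_int k = q powi k"
    using assms by (simp add: powr_def exp_power_int[symmetric])
  then show ?thesis by (simp add: powr_add mult.commute)
qed

lemma powr_of_real_power_int:
  fixes q :: complex
  assumes "q \<noteq> 0"
  shows "(q powr of_real x) powi k = q powr of_real (of_int k * x)"
  using assms by (simp add: powr_def exp_power_int mult_ac)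

text \<open>
  Writing \<open>2(x+k)\<^sup>2 - (x+k) = (2x\<^sup>2 - x) + 4kx + (2k\<^sup>2 - k)\<close>, the mixed term \<open>4kx\<close> turns
  \<open>\<alpha>\<^bsup>4k\<^esup>\<close> into \<open>(q\<^sup>x\<alpha>)\<^bsup>4k\<^esup>\<close>. This is what makes shifts of the real variable match shifts of the
  summation index.
\<close>

lemma gauss_factor_shift:
  assumes "q \<noteq> 0" "\<alpha> \<noteq> 0"
  shows "gauss_factor q \<alpha> (x + of_int k) =
    (q powi (2 * k\<^sup>2 - k) * (q powr of_real x * \<alpha>) powi (4 * k)) * gauss_factor q \<alpha> x"
proof -
  have e1: "2 * (x + of_int k)\<^sup>2 - (x + of_int k) =
      (2 * x\<^sup>2 - x + of_int (4 * k) * x) + of_int (2 * k\<^sup>2 - k)"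
    by (simp add: power2_eq_square algebra_simps)
  have e2: "4 * (x + of_int k) = 4 * x + of_int (4 * k)" by simp
  show ?thesis
    unfolding gauss_factor_def e1 e2 powr_of_real_add_int[OF assms(1)] powr_of_real_add_int[OF assms(2)]
    unfolding power_int_mult_distrib powr_of_real_power_int[OF assms(1)] of_real_add powr_add
    by (simp only: mult_ac)
qed

lemma powr_of_real_eq_exp: "q \<noteq> 0 \<Longrightarrow> q powr of_real x = exp (of_real x * Ln q)" for q :: complex
  by (simp add: powr_def)

lemma Psi_integrand_shift:
  assumes nz: "q \<noteq> 0" "\<alpha> \<noteq> 0" "a \<noteq> 0" "b \<noteq> 0" "c \<noteq> 0"
  shows "Psi_integrand m n a b c q \<alpha> (x + of_int k) =
    Psi_term m n a b c q (q powr of_real x * \<alpha>) k * gauss_factor q \<alpha> x"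
proof -
  define \<beta> where "\<beta> = q powr of_real x * \<alpha>"
  have z: "q powr of_real (x + of_int k) * \<alpha> = q powi k * \<beta>"
    unfolding powr_of_real_add_int[OF nz(1)] \<beta>_def by (simp only: mult.assoc)
  have z2: "q powr of_real (2 * (x + of_int k)) * \<alpha>\<^sup>2 = q powi (2 * k) * \<beta>\<^sup>2"
  proof -
    have "2 * (x + of_int k) = of_int 2 * x + of_int (2 * k)" by simp
    then show ?thesis
      unfolding \<beta>_def power_mult_distrib
      using powr_of_real_add_int[OF nz(1), of "of_int 2 * x" "2 * k"]
        powr_of_real_power_int[OF nz(1), of x 2] by simp
  qed
  have zu: "q powr of_real (x + of_int k + 1) * \<alpha> * t = q powi (k + 1) * \<beta> * t" for t
  proof -
    have "x + of_int k + 1 = x + of_int (k + 1)" by simp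
    then show ?thesis unfolding \<beta>_def by (simp only: powr_of_real_add_int[OF nz(1)] mult.assoc)
  qed
  have zd: "q powr of_real (1 - (x + of_int k)) * t / \<alpha> = q powi (1 - k) * t / \<beta>" for t
  proof -
    have "1 - (x + of_int k) = of_int (-1) * x + of_int (1 - k)" by simp
    then have "q powr of_real (1 - (x + of_int k)) = q powi (1 - k) * (q powr of_real x) powi (-1)"
      by (simp only: powr_of_real_add_int[OF nz(1)] powr_of_real_power_int[OF nz(1)])
    then show ?thesis unfolding \<beta>_def by (simp add: divide_inverse power_int_minus)
  qed
  have "Psi_integrand m n a b c q \<alpha> (x + of_int k) =
     (1 + q powi (2 * k) * \<beta>\<^sup>2) *
     cd_qinv_Hahn n (q powi k * \<beta>) a b c q * cd_qinv_Hahn m (q powi k * \<beta>) a b c q *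
     (\<Prod>t\<in>#{#a, b, c#}. qpochs_inf [- (q powi (k + 1) * \<beta> * t), q powi (1 - k) * t / \<beta>] q) *
     gauss_factor q \<alpha> (x + of_int k)"
    unfolding Psi_integrand_def z z2 zu zd gauss_factor_def by (simp only: mult.assoc)
  then show ?thesis
    unfolding gauss_factor_shift[OF nz(1,2)] \<beta>_def[symmetric] Psi_term_def by (simp only: mult.assoc)
qed

lemma borel_measurable_gauss_factor:
  assumes "q \<noteq> 0" "\<alpha> \<noteq> 0"
  shows "gauss_factor q \<alpha> \<in> borel_measurable borel"
  unfolding gauss_factor_def powr_of_real_eq_exp[OF assms(1)] powr_of_real_eq_exp[OF assms(2)]
  by measurable

lemma borel_measurable_Psi_integrand:
  assumes q: "0 < norm q" "norm q < 1" and nz: "\<alpha> \<noteq> 0" "a \<noteq> 0" "b \<noteq> 0" "c \<noteq> 0"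
  shows "Psi_integrand m n a b c q \<alpha> \<in> borel_measurable borel"
proof -
  have q0: "q \<noteq> 0" using q by auto
  let ?z = "\<lambda>x. exp (of_real x * Ln q) * \<alpha>"
  let ?p = "hahn_poly n a b c q * hahn_poly m a b c q"
  have zm: "?z \<in> borel_measurable borel" by measurable
  have "(\<lambda>x. poly ?p (?z x - 1 / ?z x)) \<in> borel_measurable borel"
  proof (rule borel_measurable_continuous_onI)
    show "continuous_on UNIV (\<lambda>x::real. poly ?p (?z x - 1 / ?z x))"
      using nz by (intro continuous_intros) auto
  qed
  moreover have "(\<lambda>x. theta_pair t q (?z x)) \<in> borel_measurable borel" for t
    unfolding theta_pair_def
    by (intro borel_measurable_times borel_measurable_qpoch_inf q borel_measurable_divide
        borel_measurable_uminus zm borel_measurable_const)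
  ultimately have "(\<lambda>x. poly ?p (?z x - 1 / ?z x) * ((1 + (?z x)\<^sup>2) *
      (theta_pair a q (?z x) * theta_pair b q (?z x) * theta_pair c q (?z x))) * gauss_factor q \<alpha> x)
    \<in> borel_measurable borel"
    by (intro borel_measurable_times borel_measurable_add borel_measurable_power zm
        borel_measurable_const borel_measurable_gauss_factor q0 nz)
  moreover have "Psi_integrand m n a b c q \<alpha> x = poly ?p (?z x - 1 / ?z x) * ((1 + (?z x)\<^sup>2) *
      (theta_pair a q (?z x) * theta_pair b q (?z x) * theta_pair c q (?z x))) * gauss_factor q \<alpha> x" for x
  proof -
    have "Psi_integrand m n a b c q \<alpha> x = pairing_term ?p a b c q (?z x) 0 * gauss_factor q \<alpha> x"
      using Psi_integrand_shift[OF q0 nz, of m n x 0] nz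
      by (simp add: Psi_term_eq_pairing_term[OF q0 nz(2-4)] powr_of_real_eq_exp[OF q0])
    then show ?thesis by (simp add: pairing_term_def weight_def Let_def)
  qed
  ultimately show ?thesis by (simp add: fun_eq_iff cong: measurable_cong)
qed

lemma shifted_argument_bounds:
  fixes q \<alpha> :: complex
  assumes q: "0 < norm q" "norm q < 1" and \<alpha>: "\<alpha> \<noteq> 0"
  shows "\<exists>B\<ge>0. \<forall>x. 0 \<le> x \<longrightarrow> x \<le> 1 \<longrightarrow>
    norm (q powr of_real x * \<alpha>) \<le> B \<and> norm (1 / (q powr of_real x * \<alpha>)) \<le> B"
proof -
  have "norm (q powr of_real x * \<alpha>) \<le> norm \<alpha> + norm (1 / (q * \<alpha>)) \<and>
    norm (1 / (q powr of_real x * \<alpha>)) \<le> norm \<alpha> + norm (1 / (q * \<alpha>))" if x: "0 \<le> x" "x \<le> 1" for x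
  proof -
    have n: "norm (q powr of_real x) = norm q powr x"
      by (simp add: norm_powr_real_powr')
    have "norm q powr x \<le> norm q powr 0" using q x by (intro powr_mono') auto
    then have u: "norm q powr x \<le> 1" using q by simp
    have "norm q powr 1 \<le> norm q powr x" using q x by (intro powr_mono') auto
    then have l: "norm q \<le> norm q powr x" using q by simp
    have "norm (q powr of_real x * \<alpha>) \<le> norm \<alpha>"
      unfolding norm_mult n using u by (simp add: mult_left_le_one_le)
    moreover have "norm (1 / (q powr of_real x * \<alpha>)) \<le> norm (1 / (q * \<alpha>))"
      unfolding norm_mult norm_divide n using l q \<alpha> by (intro divide_left_mono mult_right_mono) auto
    ultimately show ?thesis using norm_ge_zero[of \<alpha>] norm_ge_zero[of "1 / (q * \<alpha>)"] by linarith
  qed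
  then show ?thesis by (intro exI[of _ "norm \<alpha> + norm (1 / (q * \<alpha>))"]) auto
qed

lemma gauss_factor_bounded:
  assumes "q \<noteq> 0" "\<alpha> \<noteq> 0"
  shows "\<exists>P\<ge>0. \<forall>x. 0 \<le> x \<longrightarrow> x \<le> 1 \<longrightarrow> norm (gauss_factor q \<alpha> x) \<le> P"
proof -
  have "compact (gauss_factor q \<alpha> ` {0..1})"
    unfolding gauss_factor_def powr_of_real_eq_exp[OF assms(1)] powr_of_real_eq_exp[OF assms(2)]
    by (intro compact_continuous_image continuous_intros) auto
  then have "bounded (gauss_factor q \<alpha> ` {0..1})" by (rule compact_imp_bounded)
  then obtain P where "P > 0" "\<And>y. y \<in> gauss_factor q \<alpha> ` {0..1} \<Longrightarrow> norm y \<le> P"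
    unfolding bounded_pos by blast
  then show ?thesis by (intro exI[of _ P]) auto
qed

lemma Psi_integrand_fold:
  fixes m n :: nat
  assumes q: "0 < norm q" "norm q < 1" and nz: "\<alpha> \<noteq> 0" "a \<noteq> 0" "b \<noteq> 0" "c \<noteq> 0"
  defines "F \<equiv> \<lambda>x. Psi m n a b c q (q powr of_real x * \<alpha>) * gauss_factor q \<alpha> x"
  shows "integrable lborel (Psi_integrand m n a b c q \<alpha>)" (is ?A)
    and "set_integrable lborel {0..1} F" (is ?B)
    and "(LBINT x. Psi_integrand m n a b c q \<alpha> x) = (LBINT x:{0..1}. F x)" (is ?C)
proof -
  have q0: "q \<noteq> 0" using q by auto
  obtain B where B: "0 \<le> B" "\<And>x. 0 \<le> x \<Longrightarrow> x \<le> 1 \<Longrightarrow>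
      norm (q powr of_real x * \<alpha>) \<le> B \<and> norm (1 / (q powr of_real x * \<alpha>)) \<le> B"
    using shifted_argument_bounds[OF q nz(1)] by blast
  obtain P where P: "0 \<le> P" "\<And>x. 0 \<le> x \<Longrightarrow> x \<le> 1 \<Longrightarrow> norm (gauss_factor q \<alpha> x) \<le> P"
    using gauss_factor_bounded[OF q0 nz(1)] by blast
  obtain K where K: "K summable_on UNIV" "\<And>\<beta> k. \<beta> \<noteq> 0 \<Longrightarrow> norm \<beta> \<le> B \<Longrightarrow> norm (1 / \<beta>) \<le> B \<Longrightarrow>
      norm (Psi_term m n a b c q \<beta> k) \<le> K k"
    using pairing_term_bounded[OF q nz(2) B(1), of "hahn_poly n a b c q * hahn_poly m a b c q" b c]
    by (auto simp: Psi_term_eq_pairing_term[OF q0 nz(2-4)])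
  have bound: "norm (Psi_integrand m n a b c q \<alpha> (x + of_int k)) \<le> K k * P"
    if x: "0 \<le> x" "x \<le> 1" for x k
  proof -
    have "norm (Psi_term m n a b c q (q powr of_real x * \<alpha>) k) \<le> K k"
      using B(2)[OF x] q0 nz(1) by (intro K(2)) auto
    then show ?thesis
      unfolding Psi_integrand_shift[OF q0 nz] norm_mult[of "Psi_term _ _ _ _ _ _ _ _"]
      using P(2)[OF x] order_trans[OF norm_ge_zero] by (intro mult_mono) auto
  qed
  have KP: "(\<lambda>k. K k * P) summable_on UNIV" by (rule summable_on_cmult_left[OF K(1)])
  have F: "(\<Sum>\<^sub>\<infinity>k\<in>UNIV. Psi_integrand m n a b c q \<alpha> (x + of_int k)) = F x" for x
    unfolding Psi_integrand_shift[OF q0 nz] F_def Psi_def by (rule infsum_cmult_left')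
  note fold = line_integral_fold[OF borel_measurable_Psi_integrand[OF q nz, of m n] KP bound, unfolded F]
  show ?A ?B ?C using fold by simp_all
qed

text \<open>
  The folding of \<open>Psi_integrand_fold\<close> for the parameters \<open>a = b = c = 0\<close>, where all infinite
  products are 1 and the function on the line is elementary.
\<close>

lemma mass_000_fold:
  assumes q: "0 < norm q" "norm q < 1" and \<alpha>: "\<alpha> \<noteq> 0"
  shows "(LBINT x. (1 + (q powr of_real x * \<alpha>)\<^sup>2) * gauss_factor q \<alpha> x) =
    (LBINT x:{0..1}. mass 0 0 0 q (q powr of_real x * \<alpha>) * gauss_factor q \<alpha> x)"
proof -
  have q0: "q \<noteq> 0" using q by auto
  let ?f = "\<lambda>x::real. (1 + (q powr of_real x * \<alpha>)\<^sup>2) * gauss_factor q \<alpha> x"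
  have shift: "?f (x + of_int k) = weight 0 0 0 q (q powr of_real x * \<alpha>) k * gauss_factor q \<alpha> x" for x k
    unfolding gauss_factor_shift[OF q0 \<alpha>] powr_of_real_add_int[OF q0] weight_def Let_def
    by (simp add: mult.assoc)
  obtain B where B: "0 \<le> B" "\<And>x. 0 \<le> x \<Longrightarrow> x \<le> 1 \<Longrightarrow>
      norm (q powr of_real x * \<alpha>) \<le> B \<and> norm (1 / (q powr of_real x * \<alpha>)) \<le> B"
    using shifted_argument_bounds[OF q \<alpha>] by blast
  obtain P where P: "0 \<le> P" "\<And>x. 0 \<le> x \<Longrightarrow> x \<le> 1 \<Longrightarrow> norm (gauss_factor q \<alpha> x) \<le> P"
    using gauss_factor_bounded[OF q0 \<alpha>] by blast
  let ?K = "\<lambda>k. weight_bound (norm q) 0 B (nat \<bar>k\<bar>)"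
  have bound: "norm (?f (x + of_int k)) \<le> ?K k * P" if x: "0 \<le> x" "x \<le> 1" for x k
    unfolding shift norm_mult[of "weight _ _ _ _ _ _"] using B(2)[OF x] q0 \<alpha> B(1)
    by (intro mult_mono norm_weight_le q P x weight_bound_nonneg) auto
  have KP: "(\<lambda>k. ?K k * P) summable_on UNIV"
    by (rule summable_on_cmult_left[OF weight_bound_summable_on[OF q order.refl B(1)]])
  have meas: "?f \<in> borel_measurable borel"
    unfolding powr_of_real_eq_exp[OF q0]
    by (intro borel_measurable_times borel_measurable_gauss_factor q0 \<alpha>) measurable
  have F: "(\<Sum>\<^sub>\<infinity>k\<in>UNIV. ?f (x + of_int k)) = mass 0 0 0 q (q powr of_real x * \<alpha>) * gauss_factor q \<alpha> x" for x
    unfolding shift mass_def by (rule infsum_cmult_left')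
  show ?thesis using line_integral_fold(3)[OF meas KP bound, unfolded F] by simp
qed

text \<open>
  The summands 1 and \<open>(q\<^sup>x\<alpha>)\<^sup>2\<close> give Gaussian integrals with linear coefficients
  \<open>4 log \<alpha> \<mp> log q\<close>. They have the same value, because \<open>x \<mapsto> x + 1/2\<close> maps one integrand
  to the other.
\<close>

lemma gauss_factor_integral:
  assumes q: "0 < norm q" "norm q < 1" and \<alpha>: "\<alpha> \<noteq> 0"
  shows "(LBINT x. (1 + (q powr of_real x * \<alpha>)\<^sup>2) * gauss_factor q \<alpha> x) =
    of_real (sqrt (2 * pi)) * \<alpha> * exp (2 * (Ln \<alpha>)\<^sup>2 / (- Ln q)) / (q powr (1 / 8) * csqrt (- Ln q))"
proof -
  define l w where "l = Ln q" and "w = Ln \<alpha>"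
  have q0: "q \<noteq> 0" using q by auto
  define A where "A = - 2 * l"
  have Rl: "Re l < 0" using q q0 by (simp add: l_def Re_Ln ln_less_zero)
  have l0: "l \<noteq> 0" using Rl by auto
  have A: "Re A > 0" using Rl by (simp add: A_def)
  have \<alpha>w: "\<alpha> = exp w" using \<alpha> by (simp add: w_def)
  let ?e = "\<lambda>B x. exp (- A * of_real x ^ 2 + B * of_real x)"
  define M where "M = of_real (sqrt pi) / csqrt A * exp (w - l / 8 - 2 * w\<^sup>2 / l)"
  have split: "(1 + (q powr of_real x * \<alpha>)\<^sup>2) * gauss_factor q \<alpha> x =
      ?e (4 * w - l) x + exp (2 * w) * ?e (4 * w + l) x" for x
  proof -
    have sq: "(q powr of_real x * \<alpha>)\<^sup>2 = exp (2 * of_real x * l + 2 * w)"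
      unfolding powr_of_real_eq_exp[OF q0] \<alpha>w l_def[symmetric] exp_add[symmetric] exp_double[symmetric]
      by (rule arg_cong[where f = exp]) (simp add: algebra_simps)
    have g: "gauss_factor q \<alpha> x = ?e (4 * w - l) x"
      unfolding gauss_factor_def powr_of_real_eq_exp[OF q0] powr_of_real_eq_exp[OF \<alpha>]
        l_def[symmetric] w_def[symmetric] exp_add[symmetric] A_def
      by (rule arg_cong[where f = exp]) (simp add: algebra_simps)
    have "exp (2 * of_real x * l + 2 * w) * ?e (4 * w - l) x = exp (2 * w) * ?e (4 * w + l) x"
      unfolding exp_add[symmetric]
      by (rule arg_cong[where f = exp]) (simp add: algebra_simps)
    then show ?thesis unfolding sq g distrib_right mult_1_left by (simp only:)
  qed
  have I1: "(LBINT x. ?e (4 * w - l) x) = M"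
  proof -
    have "(4 * w - l)\<^sup>2 / (4 * A) = w - l / 8 - 2 * w\<^sup>2 / l"
      using l0 by (simp add: A_def field_simps power2_eq_square)
    then show ?thesis unfolding gaussian_integral[OF A] M_def by simp
  qed
  have I2: "exp (2 * w) * (LBINT x. ?e (4 * w + l) x) = M"
  proof -
    have "2 * w + (4 * w + l)\<^sup>2 / (4 * A) = w - l / 8 - 2 * w\<^sup>2 / l"
      using l0 by (simp add: A_def field_simps power2_eq_square)
    then have "exp (2 * w) * exp ((4 * w + l)\<^sup>2 / (4 * A)) = exp (w - l / 8 - 2 * w\<^sup>2 / l)"
      by (simp only: exp_add[symmetric])
    then show ?thesis unfolding gaussian_integral[OF A] M_def by (simp add: mult_ac)
  qed
  have "(LBINT x. (1 + (q powr of_real x * \<alpha>)\<^sup>2) * gauss_factor q \<alpha> x) = M + M"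
    unfolding split
    by (subst Bochner_Integration.integral_add)
       (simp_all only: I1 I2 integral_mult_right_zero integrable_gaussian[OF A] integrable_mult_right)
  also have "\<dots> = of_real (sqrt (2 * pi)) * \<alpha> * exp (2 * (Ln \<alpha>)\<^sup>2 / (- Ln q)) / (q powr (1 / 8) * csqrt (- Ln q))"
  proof -
    have "csqrt A = of_real (sqrt 2) * csqrt (- l)"
    proof (rule csqrt_unique)
      show "(complex_of_real (sqrt 2) * csqrt (- l))\<^sup>2 = A"
        by (simp add: power_mult_distrib A_def flip: of_real_power)
      have "0 < Re (csqrt (- l))" using less_le_trans[OF Rl norm_ge_zero[of l]] by simp
      then show "0 < Re (complex_of_real (sqrt 2) * csqrt (- l)) \<or>
          Re (complex_of_real (sqrt 2) * csqrt (- l)) = 0 \<and> 0 \<le> Im (complex_of_real (sqrt 2) * csqrt (- l))"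
        by simp
    qed
    moreover have "exp (w - l / 8 - 2 * w\<^sup>2 / l) = \<alpha> * exp (2 * (Ln \<alpha>)\<^sup>2 / (- Ln q)) / q powr (1 / 8)"
    proof -
      have e8: "q powr (1 / 8) = exp (l / 8)" using q0 by (simp add: powr_def l_def)
      have eL: "exp (2 * (Ln \<alpha>)\<^sup>2 / (- Ln q)) = inverse (exp (2 * w\<^sup>2 / l))"
        unfolding exp_minus[symmetric] by (simp add: w_def l_def)
      show ?thesis
        unfolding e8 eL exp_diff \<alpha>w[symmetric] by (simp only: divide_inverse mult_ac)
    qed
    moreover have "of_real (sqrt pi) / (of_real (sqrt 2) * X) + of_real (sqrt pi) / (of_real (sqrt 2) * X) =
        complex_of_real (sqrt (2 * pi)) / X" for X
    proof -
      have "2 / complex_of_real (sqrt 2) = complex_of_real (sqrt 2)"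
        by (metis of_real_divide of_real_numeral real_div_sqrt zero_le_numeral)
      moreover have "of_real (sqrt pi) / (of_real (sqrt 2) * X) + of_real (sqrt pi) / (of_real (sqrt 2) * X) =
          of_real (sqrt pi) * (2 / complex_of_real (sqrt 2)) / X"
        unfolding mult_2[symmetric] by (simp only: divide_inverse inverse_mult_distrib mult_ac)
      ultimately show ?thesis by (simp add: real_sqrt_mult mult.commute)
    qed
    moreover have "M + M = (of_real (sqrt pi) / csqrt A + of_real (sqrt pi) / csqrt A) * exp (w - l / 8 - 2 * w\<^sup>2 / l)"
      by (simp only: M_def distrib_right)
    ultimately show ?thesis
      unfolding l_def[symmetric] by (simp only: times_divide_times_eq times_divide_eq_left times_divide_eq_right
          divide_divide_eq_left mult_ac)
  qed
  finally show ?thesis .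
qed

theorem theorem4p8:
  fixes n m :: nat and q \<alpha> a b c :: complex
  assumes q: "0 < norm q" "norm q < 1"
    and nz: "\<alpha> \<noteq> 0" "a \<noteq> 0" "b \<noteq> 0" "c \<noteq> 0"
  shows
    "(\<forall>\<beta>. \<beta> \<noteq> 0 \<longrightarrow> Psi_term m n a b c q \<beta> summable_on UNIV) \<and>
     Psi m n a b c q \<alpha> =
       qpochs_inf [q, - \<alpha>\<^sup>2, - (q / \<alpha>\<^sup>2), - (q * a * b), - (q * a * c), - (q * b * c)] q *
       q powi (- 4 * int (n choose 2)) * (a\<^sup>2 * b\<^sup>2 * c\<^sup>2 / q) ^ n *
       qpochs [q, - (1 / (a * b)), - (1 / (a * c)), - (1 / (b * c))] q n *
       (if m = n then 1 else 0) \<and>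
     integrable lborel (Psi_integrand m n a b c q \<alpha>) \<and>
     set_integrable lborel {0..1::real}
       (\<lambda>x. Psi m n a b c q (q powr complex_of_real x * \<alpha>) *
          q powr complex_of_real (2 * x\<^sup>2 - x) * \<alpha> powr complex_of_real (4 * x)) \<and>
     (LBINT x. Psi_integrand m n a b c q \<alpha> x) =
       (LBINT x:{0..1::real}. Psi m n a b c q (q powr complex_of_real x * \<alpha>) *
          q powr complex_of_real (2 * x\<^sup>2 - x) * \<alpha> powr complex_of_real (4 * x)) \<and>
     (LBINT x:{0..1::real}. Psi m n a b c q (q powr complex_of_real x * \<alpha>) *
          q powr complex_of_real (2 * x\<^sup>2 - x) * \<alpha> powr complex_of_real (4 * x)) =
       of_real (sqrt (2 * pi)) * \<alpha> * exp (2 * (Ln \<alpha>)\<^sup>2 / (- Ln q)) *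
       qpochs_inf [- (q * a * b), - (q * a * c), - (q * b * c)] q /
       (q powr (1 / 8) * csqrt (- Ln q)) *
       q powi (- 4 * int (n choose 2)) * (a\<^sup>2 * b\<^sup>2 * c\<^sup>2 / q) ^ n *
       qpochs [q, - (1 / (a * b)), - (1 / (a * c)), - (1 / (b * c))] q n *
       (if m = n then 1 else 0)"
proof -
  have q0: "q \<noteq> 0" using q by auto
  have F: "Psi m n a b c q (q powr complex_of_real x * \<alpha>) *
      q powr complex_of_real (2 * x\<^sup>2 - x) * \<alpha> powr complex_of_real (4 * x) =
      Psi m n a b c q (q powr of_real x * \<alpha>) * gauss_factor q \<alpha> x" for x
    by (simp add: gauss_factor_def)
  have pw: "q powi (- 4 * int (n choose 2)) = 1 / (q ^ (n choose 2)) ^ 4"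
  proof -
    have "- 4 * int (n choose 2) = - int ((n choose 2) * 4)" by simp
    then show ?thesis by (simp only: power_int_minus power_int_of_nat power_mult inverse_eq_divide)
  qed
  have C: "Psi_const m n a b c q = qpochs_inf [- (q * a * b), - (q * a * c), - (q * b * c)] q *
      q powi (- 4 * int (n choose 2)) * (a\<^sup>2 * b\<^sup>2 * c\<^sup>2 / q) ^ n *
      qpochs [q, - (1 / (a * b)), - (1 / (a * c)), - (1 / (b * c))] q n * (if m = n then 1 else 0)"
    unfolding pw by (simp add: Psi_const_def qpochs_inf_def qpochs_def mult.assoc)
  have "Psi_term m n a b c q \<beta> summable_on UNIV" if "\<beta> \<noteq> 0" for \<beta>
    unfolding Psi_term_eq_pairing_term[OF q0 nz(2-4) that] by (rule pairing_summable[OF q nz(2) that])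
  moreover have "Psi m n a b c q \<alpha> =
       qpochs_inf [q, - \<alpha>\<^sup>2, - (q / \<alpha>\<^sup>2), - (q * a * b), - (q * a * c), - (q * b * c)] q *
       q powi (- 4 * int (n choose 2)) * (a\<^sup>2 * b\<^sup>2 * c\<^sup>2 / q) ^ n *
       qpochs [q, - (1 / (a * b)), - (1 / (a * c)), - (1 / (b * c))] q n *
       (if m = n then 1 else 0)"
    unfolding Psi_eq_mass[OF q nz(2-4,1)] C mass_000[OF q nz(1)] by (simp add: qpochs_inf_def mult_ac)
  moreover have "(LBINT x:{0..1}. Psi m n a b c q (q powr of_real x * \<alpha>) * gauss_factor q \<alpha> x) =
      Psi_const m n a b c q *
      (of_real (sqrt (2 * pi)) * \<alpha> * exp (2 * (Ln \<alpha>)\<^sup>2 / (- Ln q)) / (q powr (1 / 8) * csqrt (- Ln q)))"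
  proof -
    have "Psi m n a b c q (q powr of_real x * \<alpha>) * gauss_factor q \<alpha> x =
        Psi_const m n a b c q * (mass 0 0 0 q (q powr of_real x * \<alpha>) * gauss_factor q \<alpha> x)" for x
      using Psi_eq_mass[OF q nz(2-4), of "q powr of_real x * \<alpha>" m n] q0 nz(1) by simp
    then show ?thesis
      by (simp only: set_integral_mult_right mass_000_fold[OF q nz(1), symmetric]
          gauss_factor_integral[OF q nz(1)])
  qed
  ultimately show ?thesis
    unfolding F using Psi_integrand_fold[OF q nz, of m n] by (simp add: C)
qed

end
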